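(* Let $X$ be a compact metric space and let $P_t$, $t\ge0$, be a Markov semigroup on $C(X)$ with generator $L$ satisfying conditions (A), (B), (C), (D) listed in the context. Let $V_1,V_2\in C(X)$ be smooth potentials. If $\mu\in M(X)$ is an equilibrium measure for $V_1$ and for $V_2$, then $V_1-V_2$ is a constant.
   Context: $C(X)$ is the space of real continuous functions on the compact metric space $X$ with the sup norm $\|\cdot\|$; $B(X)$ is the space of bounded Borel functions on $X$; $M(X)$ is the space of Borel probability measures on $X$; $\mu(f)=\int_X f\,d\mu$. A Markov semigroup on $C(X)$ is a semigroup $P_t$, $t\ge0$, of bounded operators on $C(X)$ with $P_tf\ge0$ for $f\ge0$, $\|P_tf-f\|\to0$ as $t\to0+$ for all $f\in C(X)$, and $P_t1=1$. Its generator is $Lf=\lim_{t\to0+}\frac1t(P_tf-f)$ (limit in $C(X)$), defined on the dense domain $\mathcal D\subset C(X)$ where the limit exists. $\mathcal D^+$ is the set of strictly positive functions in $\mathcal D$. For $V\in C(X)$, the Schrodinger semigroup $P_t^V$, $t\ge0$, on $C(X)$ is the strongly continuous positive semigroup generated by $L+V$; equivalently $u(t)=P_t^Vf$ is the unique solution of $u(t)=P_tf+\int_0^tP_{t-s}Vu(s)\,ds$, $t\ge0$, for $f\in C(X)$. By positivity $P_t^Vf(x)=\int_X p^V(t,x,dy)f(y)$ for a family of bounded positive measures $p^V(t,x,\cdot)$, and this formula defines $P_t^Vf$ for $f\in B(X)$. The principal eigenvalue is $\lambda_V=\lim_{t\to\infty}\frac1t\log\|P_t^V\|$; it is given by the Donsker-Varadhan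 formula $\lambda_V=\sup_{\mu\in M(X)}\left(\int_XV\,d\mu-I(\mu)\right)$, where $I(\mu)=-\inf_{u\in\mathcal D^+}\int_X\frac{Lu}{u}\,d\mu$. An equilibrium measure for $V$ is a $\mu\in M(X)$ with $\lambda_V=\mu(V)-I(\mu)$. A core for $P_t$, $t\ge0$, is a subspace $\mathcal D^\infty\subset\mathcal D$ whose closure in the graph norm $\|f\|+\|Lf\|$ equals $\mathcal D$. The conditions are: (A) There are $T>0$ and $\epsilon=\epsilon(T)>0$ such that $P_T|f|(x)\ge\epsilon P_T|f|(y)$ for all $x,y\in X$ and $f\in C(X)$. (B) There is a $T>0$ such that for every $f\in C(X)$ with $f\ge0$ and $f\not\equiv0$, $P_Tf>0$ everywhere in $X$. (C) There is a core $\mathcal D^\infty$ that is closed under multiplication and division: if $f,g\in\mathcal D^\infty$ then $fg\in\mathcal D^\infty$, and if moreover $g>0$, then $f/g\in\mathcal D^\infty$. (D) For the core $\mathcal D^\infty$ of (C), with $\Gamma(g)=L(g^2)-2gLg$ for $g\in\mathcal D^\infty$: if $g\in\mathcal D^\infty$ and $\Gamma(g)\equiv0$, then $g$ is a constant. A potential $V\in C(X)$ is smooth if $P_t^V$ maps $B(X)$ into $\mathcal D^\infty$ for every $t>0$, with $\mathcal D^\infty$ the core of (C). *)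

theory Defs
  imports "HOL-Probability.Probability"
begin

text \<open>
  The compact metric space is a type \<open>'a :: metric_space\<close> together with the hypothesis
  \<open>compact (UNIV :: 'a set)\<close>, which is stated in the theorem.  Under it the Banach space
  \<open>'a \<Rightarrow>\<^sub>C real\<close> of bounded continuous functions is the space of all
  continuous functions with the sup norm.  The one-parameter families below are indexed by
  \<open>real\<close>; only their values at times \<open>t \<ge> 0\<close> matter.
\<close>

definition bc_mult :: "('a::topological_space \<Rightarrow>\<^sub>C real) \<Rightarrow> ('a \<Rightarrow>\<^sub>C real) \<Rightarrow> ('a \<Rightarrow>\<^sub>C real)" where
  "bc_mult f g = Bcontfun (\<lambda>x. f x * g x)"

lemma apply_bc_mult [simp]: "bc_mult f g x = f x * g x"
proof -
  have "norm (f y * g y) \<le> norm f * norm g" for y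
    unfolding norm_mult by (intro mult_mono norm_bounded norm_ge_zero)
  then have "(\<lambda>x. f x * g x) \<in> bcontfun"
    by (auto simp: bcontfun_def intro!: continuous_on_mult boundedI[where B = "norm f * norm g"])
  then show ?thesis
    by (simp add: bc_mult_def Bcontfun_inverse)
qed

definition bc_abs :: "('a::topological_space \<Rightarrow>\<^sub>C real) \<Rightarrow> ('a \<Rightarrow>\<^sub>C real)" where
  "bc_abs f = Bcontfun (\<lambda>x. \<bar>f x\<bar>)"

lemma apply_bc_abs [simp]: "bc_abs f x = \<bar>f x\<bar>"
proof -
  have "bounded (range (apply_bcontfun f))" by simp
  then have "(\<lambda>x. \<bar>f x\<bar>) \<in> bcontfun"
    by (auto simp: bcontfun_def bounded_iff intro!: continuous_intros)
  then show ?thesis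
    by (simp add: bc_abs_def Bcontfun_inverse)
qed


subsection \<open>Markov semigroups and their generators\<close>

definition markov_semigroup ::
  "(real \<Rightarrow> ('a::metric_space \<Rightarrow>\<^sub>C real) \<Rightarrow> ('a \<Rightarrow>\<^sub>C real)) \<Rightarrow> bool" where
  "markov_semigroup P \<longleftrightarrow>
     (\<forall>t\<ge>0. bounded_linear (P t)) \<and>
     P 0 = id \<and>
     (\<forall>s\<ge>0. \<forall>t\<ge>0. P (s + t) = P s \<circ> P t) \<and>
     (\<forall>t\<ge>0. \<forall>f. (\<forall>x. apply_bcontfun f x \<ge> 0) \<longrightarrow> (\<forall>x. P t f x \<ge> 0)) \<and>
     (\<forall>f. ((\<lambda>t. norm (P t f - f)) \<longlongrightarrow> 0) (at_right 0)) \<and>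
     (\<forall>t\<ge>0. P t (const_bcontfun 1) = const_bcontfun 1)"

definition gen_domain ::
  "(real \<Rightarrow> ('a::metric_space \<Rightarrow>\<^sub>C real) \<Rightarrow> ('a \<Rightarrow>\<^sub>C real)) \<Rightarrow> ('a \<Rightarrow>\<^sub>C real) set" where
  "gen_domain P = {f. \<exists>g. ((\<lambda>t. (1 / t) *\<^sub>R (P t f - f)) \<longlongrightarrow> g) (at_right 0)}"

definition generator ::
  "(real \<Rightarrow> ('a::metric_space \<Rightarrow>\<^sub>C real) \<Rightarrow> ('a \<Rightarrow>\<^sub>C real)) \<Rightarrow> ('a \<Rightarrow>\<^sub>C real) \<Rightarrow> ('a \<Rightarrow>\<^sub>C real)" where
  "generator P f = Lim (at_right 0) (\<lambda>t. (1 / t) *\<^sub>R (P t f - f))"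

definition pos_domain ::
  "(real \<Rightarrow> ('a::metric_space \<Rightarrow>\<^sub>C real) \<Rightarrow> ('a \<Rightarrow>\<^sub>C real)) \<Rightarrow> ('a \<Rightarrow>\<^sub>C real) set" where
  "pos_domain P = {u \<in> gen_domain P. \<forall>x. u x > 0}"

definition is_core ::
  "(real \<Rightarrow> ('a::metric_space \<Rightarrow>\<^sub>C real) \<Rightarrow> ('a \<Rightarrow>\<^sub>C real)) \<Rightarrow> ('a \<Rightarrow>\<^sub>C real) set \<Rightarrow> bool" where
  "is_core P D \<longleftrightarrow>
     subspace D \<and> D \<subseteq> gen_domain P \<and>
     (\<forall>f\<in>gen_domain P. \<forall>e>0. \<exists>g\<in>D. norm (f - g) + norm (generator P (f - g)) < e)"

definition carre_du_champ ::
  "(real \<Rightarrow> ('a::metric_space \<Rightarrow>\<^sub>C real) \<Rightarrow> ('a \<Rightarrow>\<^sub>C real)) \<Rightarrow> ('a \<Rightarrow>\<^sub>C real) \<Rightarrow> ('a \<Rightarrow>\<^sub>C real)" where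
  "carre_du_champ P g = generator P (bc_mult g g) - 2 *\<^sub>R bc_mult g (generator P g)"


subsection \<open>Conditions (A)--(D)\<close>

definition cond_A ::
  "(real \<Rightarrow> ('a::metric_space \<Rightarrow>\<^sub>C real) \<Rightarrow> ('a \<Rightarrow>\<^sub>C real)) \<Rightarrow> bool" where
  "cond_A P \<longleftrightarrow>
     (\<exists>T>0. \<exists>\<epsilon>>0. \<forall>x y f. P T (bc_abs f) x \<ge> \<epsilon> * P T (bc_abs f) y)"

definition cond_B ::
  "(real \<Rightarrow> ('a::metric_space \<Rightarrow>\<^sub>C real) \<Rightarrow> ('a \<Rightarrow>\<^sub>C real)) \<Rightarrow> bool" where
  "cond_B P \<longleftrightarrow>
     (\<exists>T>0. \<forall>f. (\<forall>x. apply_bcontfun f x \<ge> 0) \<and> f \<noteq> 0 \<longrightarrow> (\<forall>x. P T f x > 0))"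

definition cond_C ::
  "(real \<Rightarrow> ('a::metric_space \<Rightarrow>\<^sub>C real) \<Rightarrow> ('a \<Rightarrow>\<^sub>C real)) \<Rightarrow> ('a \<Rightarrow>\<^sub>C real) set \<Rightarrow> bool" where
  "cond_C P D \<longleftrightarrow>
     is_core P D \<and>
     (\<forall>f\<in>D. \<forall>g\<in>D. bc_mult f g \<in> D) \<and>
     (\<forall>f\<in>D. \<forall>g\<in>D. (\<forall>x. apply_bcontfun g x > 0) \<longrightarrow> (\<exists>h\<in>D. \<forall>x. h x = f x / g x))"

definition cond_D ::
  "(real \<Rightarrow> ('a::metric_space \<Rightarrow>\<^sub>C real) \<Rightarrow> ('a \<Rightarrow>\<^sub>C real)) \<Rightarrow> ('a \<Rightarrow>\<^sub>C real) set \<Rightarrow> bool" where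
  "cond_D P D \<longleftrightarrow>
     (\<forall>g\<in>D. carre_du_champ P g = 0 \<longrightarrow> (\<exists>c. g = const_bcontfun c))"


subsection \<open>Schrodinger semigroups\<close>

definition duhamel_solution ::
  "(real \<Rightarrow> ('a::metric_space \<Rightarrow>\<^sub>C real) \<Rightarrow> ('a \<Rightarrow>\<^sub>C real)) \<Rightarrow> ('a \<Rightarrow>\<^sub>C real) \<Rightarrow> ('a \<Rightarrow>\<^sub>C real) \<Rightarrow>
     (real \<Rightarrow> 'a \<Rightarrow>\<^sub>C real) \<Rightarrow> bool" where
  "duhamel_solution P V f u \<longleftrightarrow>
     continuous_on {0..} u \<and>
     (\<forall>t\<ge>0. ((\<lambda>s. P (t - s) (bc_mult V (u s))) has_integral (u t - P t f)) {0..t})"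

text \<open>
  The semigroup generated by \<open>L + V\<close>, through its characterisation as the unique solution of
  \<open>u(t) = P\<^sub>t f + \<integral> P\<^sub>t\<^sub>-\<^sub>s V u(s) ds\<close> (integral over \<open>[0,t]\<close>).  The description operator is
  applied to the value \<open>u t\<close> because \<open>u\<close> is determined only at nonnegative times.
\<close>
definition schrodinger ::
  "(real \<Rightarrow> ('a::metric_space \<Rightarrow>\<^sub>C real) \<Rightarrow> ('a \<Rightarrow>\<^sub>C real)) \<Rightarrow> ('a \<Rightarrow>\<^sub>C real) \<Rightarrow>
     real \<Rightarrow> ('a \<Rightarrow>\<^sub>C real) \<Rightarrow> ('a \<Rightarrow>\<^sub>C real)" where
  "schrodinger P V t f = (THE g. \<exists>u. duhamel_solution P V f u \<and> g = u t)"

definition schrodinger_kernel ::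
  "(real \<Rightarrow> ('a::metric_space \<Rightarrow>\<^sub>C real) \<Rightarrow> ('a \<Rightarrow>\<^sub>C real)) \<Rightarrow> ('a \<Rightarrow>\<^sub>C real) \<Rightarrow>
     (real \<Rightarrow> 'a \<Rightarrow> 'a measure) \<Rightarrow> bool" where
  "schrodinger_kernel P V p \<longleftrightarrow>
     (\<forall>t\<ge>0. \<forall>x. finite_measure (p t x) \<and> sets (p t x) = sets borel \<and>
        (\<forall>f. schrodinger P V t f x = (\<integral>y. apply_bcontfun f y \<partial>p t x)))"

text \<open>
  On the bounded Borel functions the semigroup acts through its kernel, which exists and is unique
  by the Riesz representation theorem.
\<close>
definition smooth_potential ::
  "(real \<Rightarrow> ('a::metric_space \<Rightarrow>\<^sub>C real) \<Rightarrow> ('a \<Rightarrow>\<^sub>C real)) \<Rightarrow> ('a \<Rightarrow>\<^sub>C real) set \<Rightarrow>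
     ('a \<Rightarrow>\<^sub>C real) \<Rightarrow> bool" where
  "smooth_potential P D V \<longleftrightarrow>
     (\<exists>p. schrodinger_kernel P V p \<and>
        (\<forall>t>0. \<forall>f::'a \<Rightarrow> real. f \<in> borel_measurable borel \<and> bounded (range f) \<longrightarrow>
           (\<exists>g\<in>D. \<forall>x. g x = (\<integral>y. f y \<partial>p t x))))"


subsection \<open>Principal eigenvalue and equilibrium measures\<close>

definition principal_eigenvalue ::
  "(real \<Rightarrow> ('a::metric_space \<Rightarrow>\<^sub>C real) \<Rightarrow> ('a \<Rightarrow>\<^sub>C real)) \<Rightarrow> ('a \<Rightarrow>\<^sub>C real) \<Rightarrow> real" where
  "principal_eigenvalue P V = Lim at_top (\<lambda>t. (1 / t) * ln (onorm (schrodinger P V t)))"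

definition borel_prob :: "'a::metric_space measure \<Rightarrow> bool" where
  "borel_prob \<mu> \<longleftrightarrow> prob_space \<mu> \<and> sets \<mu> = sets borel"

text \<open>The infimum may be minus infinity, so the rate takes values in the extended reals.\<close>
definition dv_rate ::
  "(real \<Rightarrow> ('a::metric_space \<Rightarrow>\<^sub>C real) \<Rightarrow> ('a \<Rightarrow>\<^sub>C real)) \<Rightarrow> 'a measure \<Rightarrow> ereal" where
  "dv_rate P \<mu> = - (INF u\<in>pos_domain P. ereal (\<integral>x. generator P u x / u x \<partial>\<mu>))"

definition equilibrium_measure ::
  "(real \<Rightarrow> ('a::metric_space \<Rightarrow>\<^sub>C real) \<Rightarrow> ('a \<Rightarrow>\<^sub>C real)) \<Rightarrow> ('a \<Rightarrow>\<^sub>C real) \<Rightarrow> 'a measure \<Rightarrow> bool" where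
  "equilibrium_measure P V \<mu> \<longleftrightarrow>
     borel_prob \<mu> \<and>
     ereal (principal_eigenvalue P V) = ereal (\<integral>x. V x \<partial>\<mu>) - dv_rate P \<mu>"

end

theory Submission
  imports Defs
begin

text \<open>
  Write \<open>L\<close> for the generator and \<open>\<lambda>\<^sub>V\<close> for the principal eigenvalue of \<open>V\<close>.  A ground state of
  \<open>V\<close> is a strictly positive \<open>\<psi>\<close> in the core with \<open>L\<psi> + V\<psi> = \<lambda>\<^sub>V \<psi>\<close>.  The idea is that an
  equilibrium measure \<open>\<mu>\<close> of two potentials forces their ground states to be proportional, and the
  ground state determines the potential up to a constant, because \<open>V - \<lambda>\<^sub>V = - L\<psi> / \<psi>\<close>.

  Ground states exist (\<open>ground_state_exists\<close>).  Condition (A) passes from \<open>P\<^sub>T\<close> to the Schrodinger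
  operator \<open>K\<close> at time \<open>T\<close>, since the two operators differ at most by the factors
  \<open>exp (\<plusminus> T \<parallel>V\<parallel>)\<close> on nonnegative functions.  A positive operator with such a Harnack inequality
  contracts the oscillation of ratios \<open>f / g\<close> (Birkhoff), so normalised iterates of \<open>1\<close> converge to
  a positive eigenvector of \<open>K\<close>, which is unique up to scaling.  Uniqueness makes it an eigenvector of
  the Schrodinger semigroup at all times, and smoothness of \<open>V\<close> puts it into the core.  A positive
  eigenvector can only belong to the principal eigenvalue (\<open>principal_eigenvalue_eqI\<close>).

  For an equilibrium measure the ground state minimises \<open>u \<mapsto> \<integral> Lu / u d\<mu>\<close> over the positive
  functions in the domain (\<open>ground_state_minimises\<close>).  The first variation at the minimiser says that
  \<open>d\<mu> / \<psi>\<close> annihilates the range of \<open>L + V - \<lambda>\<^sub>V\<close> (\<open>equilibrium_ground_state\<close>), and by (B) a measure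
  with this property charges every nonempty open set (\<open>stationary_measure_full_support\<close>).

  Let now \<open>\<mu>\<close> be an equilibrium measure for both potentials, with ground states \<open>\<psi>\<^sub>1\<close>, \<open>\<psi>\<^sub>2\<close>, and let
  \<open>h = \<psi>\<^sub>2 / \<psi>\<^sub>1\<close>, which lies in the core by (C).  Subtracting the stationarity relation of \<open>\<psi>\<^sub>1\<close>
  tested with \<open>\<psi>\<^sub>2\<close> from the one of \<open>\<psi>\<^sub>2\<close> tested with \<open>\<psi>\<^sub>1 h\<^sup>2\<close> gives
  \<open>\<integral> G / \<psi>\<^sub>2 d\<mu> = 0\<close> with \<open>G = L(\<psi>\<^sub>1 h\<^sup>2) - 2 h L(\<psi>\<^sub>1 h) + h\<^sup>2 L\<psi>\<^sub>1\<close>.  The positive maximum principle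
  gives \<open>G \<ge> (min \<psi>\<^sub>1) \<Gamma>(h) \<ge> 0\<close>, so full support yields \<open>\<Gamma>(h) = 0\<close>, and \<open>h\<close> is constant by (D).
\<close>

section \<open>Bounded continuous functions\<close>

instance bcontfun :: (metric_space, banach) banach ..

lemma apply_le_norm: "f x \<le> norm f" and neg_norm_le_apply: "- norm f \<le> f x"
  for f :: "'a::topological_space \<Rightarrow>\<^sub>C real"
  using norm_bounded[of f x] by auto

lemma bounded_linear_eval: "bounded_linear (\<lambda>f::'a::topological_space \<Rightarrow>\<^sub>C real. f x)"
proof (rule bounded_linear_intro[where K = 1])
  fix f :: "'a \<Rightarrow>\<^sub>C real"
  show "norm (f x) \<le> norm f * 1"
    using norm_bounded[of f x] by simp
qed auto

lemma bounded_bilinear_bc_mult: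
  "bounded_bilinear (bc_mult :: ('a::topological_space \<Rightarrow>\<^sub>C real) \<Rightarrow> _ \<Rightarrow> _)"
proof
  show "\<exists>K. \<forall>a b. norm (bc_mult a b :: 'a \<Rightarrow>\<^sub>C real) \<le> norm a * norm b * K"
  proof (intro exI[of _ 1] allI norm_bound)
    fix a b :: "'a \<Rightarrow>\<^sub>C real" and x
    show "norm (bc_mult a b x) \<le> norm a * norm b * 1"
      unfolding apply_bc_mult norm_mult by (simp add: mult_mono norm_bounded del: real_norm_def)
  qed
qed (auto intro!: bcontfun_eqI simp: algebra_simps)

interpretation bc_mult: bounded_bilinear "bc_mult :: ('a::topological_space \<Rightarrow>\<^sub>C real) \<Rightarrow> _ \<Rightarrow> _"
  by (rule bounded_bilinear_bc_mult)

lemma norm_bc_mult_le: "norm (bc_mult a b) \<le> norm a * norm b"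
  for a b :: "'a::topological_space \<Rightarrow>\<^sub>C real"
proof (rule norm_bound)
  fix x show "norm (bc_mult a b x) \<le> norm a * norm b"
    unfolding apply_bc_mult norm_mult by (intro mult_mono norm_bounded norm_ge_zero)
qed

lemma bcontfun_of_continuous:
  assumes "compact (UNIV :: 'a::metric_space set)" and "continuous_on UNIV (f :: 'a \<Rightarrow> real)"
  obtains g :: "'a::metric_space \<Rightarrow>\<^sub>C real" where "\<And>x. g x = f x"
proof -
  have "bounded (range f)"
    using assms compact_continuous_image compact_imp_bounded by blast
  then have "f \<in> bcontfun"
    using assms by (simp add: bcontfun_def)
  then show thesis
    using that[of "Bcontfun f"] by (simp add: Bcontfun_inverse)
qed

lemma positive_bounded_below:
  assumes "compact (UNIV :: 'a::metric_space set)" and "\<And>x. apply_bcontfun f (x::'a::metric_space) > (0::real)"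
  obtains m where "m > 0" "\<And>x. m \<le> f x"
proof -
  have "compact (range f)"
    using assms(1) by (rule compact_continuous_image[rotated]) auto
  then obtain y where "y \<in> range f" "\<And>z. z \<in> range f \<Longrightarrow> y \<le> z"
    using compact_attains_inf[of "range f"] by auto
  then show thesis
    using that[of y] assms(2) by auto
qed

lemma le_0_of_geometric:
  fixes a b q :: real
  assumes "\<And>n. a \<le> b * q ^ n" "0 \<le> q" "q < 1"
  shows "a \<le> 0"
proof (rule LIMSEQ_le_const[of "\<lambda>n. b * q ^ n"])
  show "(\<lambda>n. b * q ^ n) \<longlonglongrightarrow> 0"
    using assms tendsto_mult_right_zero[OF LIMSEQ_power_zero[of q]] by simp
qed (use assms in auto)

section \<open>Markov semigroups\<close>

locale markov =
  fixes P :: "real \<Rightarrow> ('a::metric_space \<Rightarrow>\<^sub>C real) \<Rightarrow> ('a \<Rightarrow>\<^sub>C real)"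
  assumes markov_semigroup: "markov_semigroup P"
begin

lemma bounded_linear_P: "t \<ge> 0 \<Longrightarrow> bounded_linear (P t)"
  and P_0 [simp]: "P 0 f = f"
  and P_add: "s \<ge> 0 \<Longrightarrow> t \<ge> 0 \<Longrightarrow> P (s + t) f = P s (P t f)"
  and P_nonneg: "t \<ge> 0 \<Longrightarrow> (\<And>x. apply_bcontfun f x \<ge> 0) \<Longrightarrow> P t f x \<ge> 0"
  and P_strongly_continuous: "((\<lambda>t. norm (P t f - f)) \<longlongrightarrow> 0) (at_right 0)"
  and P_1: "t \<ge> 0 \<Longrightarrow> P t (const_bcontfun 1) = const_bcontfun 1"
  using markov_semigroup unfolding markov_semigroup_def by auto

lemma P_linear:
  assumes "t \<ge> 0"
  shows "P t (f + g) = P t f + P t g" "P t (f - g) = P t f - P t g"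
    "P t (c *\<^sub>R f) = c *\<^sub>R P t f" "P t 0 = 0" "P t (- f) = - P t f"
proof -
  interpret bounded_linear "P t" using assms by (rule bounded_linear_P)
  show "P t (f + g) = P t f + P t g" "P t (f - g) = P t f - P t g"
    "P t (c *\<^sub>R f) = c *\<^sub>R P t f" "P t 0 = 0" "P t (- f) = - P t f"
    by (rule add diff scale zero neg)+
qed

lemma P_const: "t \<ge> 0 \<Longrightarrow> P t (const_bcontfun c) = const_bcontfun c"
proof -
  assume "t \<ge> 0"
  have c: "const_bcontfun c = c *\<^sub>R (const_bcontfun 1 :: 'a \<Rightarrow>\<^sub>C real)"
    by (rule bcontfun_eqI) simp
  show ?thesis
    using \<open>t \<ge> 0\<close> by (subst (1 2) c) (simp add: P_linear P_1)
qed

lemma P_mono: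
  assumes "t \<ge> 0" "\<And>x. apply_bcontfun f x \<le> apply_bcontfun g x"
  shows "P t f x \<le> P t g x"
  using P_nonneg[of t "g - f" x] assms by (simp add: P_linear)

lemma norm_P_le:
  assumes "t \<ge> 0"
  shows "norm (P t f) \<le> norm f"
proof (rule norm_bound)
  fix x
  have "P t f x \<le> P t (const_bcontfun (norm f)) x" "P t (const_bcontfun (- norm f)) x \<le> P t f x"
    by (intro P_mono assms; simp add: apply_le_norm neg_norm_le_apply)+
  then show "norm (P t f x) \<le> norm f"
    using assms by (simp add: P_const)
qed

text \<open>
  Continuity of \<open>P\<close> in time and argument at once.  Only the time difference enters on the right-hand
  side, because the common part of the two times acts as a contraction.
\<close>
lemma norm_P_diff_le:
  assumes "s \<ge> 0" "t \<ge> 0"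
  shows "norm (P s f - P t g) \<le> norm (f - g) + norm (P \<bar>s - t\<bar> g - g)"
proof -
  have *: "norm (P s g - P t g) \<le> norm (P \<bar>s - t\<bar> g - g)" if "s \<ge> 0" "t \<ge> 0" "t \<le> s" for s t
  proof -
    have "P s g = P t (P (s - t) g)"
      using P_add[of t "s - t"] that by simp
    then have "P s g - P t g = P t (P (s - t) g - g)"
      using that by (simp add: P_linear)
    then show ?thesis
      using that norm_P_le[of t "P (s - t) g - g"] by simp
  qed
  have g: "norm (P s g - P t g) \<le> norm (P \<bar>s - t\<bar> g - g)"
  proof (cases "t \<le> s")
    case False
    then show ?thesis
      using *[of t s] assms by (simp add: norm_minus_commute abs_minus_commute)
  qed (use * assms in auto)
  have "P s f - P t g = P s (f - g) + (P s g - P t g)"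
    using assms by (simp add: P_linear)
  then have "norm (P s f - P t g) \<le> norm (P s (f - g)) + norm (P s g - P t g)"
    by (simp only: norm_triangle_ineq)
  then show ?thesis
    using norm_P_le[of s "f - g"] assms(1) g by linarith
qed

lemma continuous_on_P [continuous_intros]:
  fixes a :: "'b::topological_space \<Rightarrow> real"
  assumes a: "continuous_on A a" and b: "continuous_on A b" and "\<And>x. x \<in> A \<Longrightarrow> a x \<ge> 0"
  shows "continuous_on A (\<lambda>x. P (a x) (b x))"
  unfolding continuous_on_def
proof
  fix x assume x: "x \<in> A"
  define N where "N = (\<lambda>s. norm (P s (b x) - b x))"
  have "isCont (\<lambda>r. N \<bar>r\<bar>) 0"
  proof -
    have r: "(\<lambda>r. N \<bar>r\<bar>) \<midarrow>0\<rightarrow> 0"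
    proof (rule filterlim_split_at)
      have "((\<lambda>t. norm (P t (b x) - b x)) \<longlongrightarrow> 0) (at_right 0)"
        by (rule P_strongly_continuous)
      then have N: "(N \<longlongrightarrow> 0) (at_right 0)"
        by (simp add: N_def)
      have ev: "eventually (\<lambda>r. N r = N \<bar>r\<bar>) (at_right 0)"
        by (auto simp: eventually_at_filter)
      show "((\<lambda>r. N \<bar>r\<bar>) \<longlongrightarrow> 0) (at_right 0)"
        using N ev by (rule Lim_transform_eventually)
      then show "((\<lambda>r. N \<bar>r\<bar>) \<longlongrightarrow> 0) (at_left 0)"
        by (subst filterlim_at_left_to_right) simp
    qed
    then show ?thesis
      unfolding isCont_def by (simp add: N_def)
  qed
  then have "((\<lambda>y. N \<bar>a y - a x\<bar>) \<longlongrightarrow> N \<bar>0\<bar>) (at x within A)"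
    by (rule isCont_tendsto_compose)
      (use a x in \<open>auto simp: continuous_on_def intro!: LIM_zero\<close>)
  moreover have "((\<lambda>y. norm (b y - b x)) \<longlongrightarrow> 0) (at x within A)"
    using b x by (auto simp: continuous_on_def intro!: tendsto_norm_zero LIM_zero)
  ultimately have lim: "((\<lambda>y. norm (b y - b x) + N \<bar>a y - a x\<bar>) \<longlongrightarrow> 0) (at x within A)"
    using tendsto_add[of _ 0 _ _ "N \<bar>0\<bar>"] by (fastforce simp: N_def)
  have "((\<lambda>y. P (a y) (b y) - P (a x) (b x)) \<longlongrightarrow> 0) (at x within A)"
  proof (rule Lim_null_comparison[OF _ lim])
    show "\<forall>\<^sub>F y in at x within A. norm (P (a y) (b y) - P (a x) (b x)) \<le> norm (b y - b x) + N \<bar>a y - a x\<bar>"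
      unfolding eventually_at_filter N_def
      by (rule always_eventually) (use norm_P_diff_le assms(3) x in auto)
  qed
  then show "((\<lambda>y. P (a y) (b y)) \<longlongrightarrow> P (a x) (b x)) (at x within A)"
    by (rule LIM_zero_cancel)
qed

lemma has_integral_P:
  assumes "(f has_integral I) S" "t \<ge> 0"
  shows "((\<lambda>s. P t (f s)) has_integral P t I) S"
  using has_integral_linear[OF assms(1) bounded_linear_P[OF assms(2)]] by (simp add: o_def)

section \<open>Duhamel's equation\<close>

definition convol :: "(real \<Rightarrow> ('a \<Rightarrow>\<^sub>C real)) \<Rightarrow> real \<Rightarrow> ('a \<Rightarrow>\<^sub>C real)" where
  "convol g t = integral {0..t} (\<lambda>s. P (t - s) (g s))"

text \<open>
  The average of the Duhamel integrand over \<open>[0,t]\<close>, rescaled to a fixed interval.  In this form it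
  depends continuously on \<open>t\<close>, including at \<open>t = 0\<close>, where \<open>convol g t / t\<close> has no meaning.
\<close>
definition convol_mean :: "(real \<Rightarrow> ('a \<Rightarrow>\<^sub>C real)) \<Rightarrow> real \<Rightarrow> ('a \<Rightarrow>\<^sub>C real)" where
  "convol_mean g t = integral {0..1} (\<lambda>r. P (t * (1 - r)) (g (t * r)))"

lemma convol_integrand_continuous:
  assumes "continuous_on {0..} g" "t \<ge> 0"
  shows "continuous_on {0..t} (\<lambda>s. P (t - s) (g s))"
  by (intro continuous_intros continuous_on_subset[OF assms(1)]) auto

lemma has_integral_convol:
  assumes "continuous_on {0..} g" "t \<ge> 0"
  shows "((\<lambda>s. P (t - s) (g s)) has_integral convol g t) {0..t}"
  unfolding convol_def
  by (intro integrable_integral integrable_continuous_interval convol_integrand_continuous assms)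

lemma convol_eq_mean:
  assumes g: "continuous_on {0..} g" and "t \<ge> 0"
  shows "convol g t = t *\<^sub>R convol_mean g t"
proof (cases "t = 0")
  case False
  then have "t > 0" using assms by simp
  have "((\<lambda>s. P (t - s) (g s)) has_integral convol g t) (cbox 0 t)"
    using has_integral_convol[OF assms] by simp
  from has_integral_affinity'[OF this \<open>t > 0\<close>, of 0]
  have "((\<lambda>r. P (t * (1 - r)) (g (t * r))) has_integral (convol g t /\<^sub>R t)) {0..1}"
    using \<open>t > 0\<close> by (simp add: algebra_simps)
  then have "convol_mean g t = convol g t /\<^sub>R t"
    unfolding convol_mean_def by (rule integral_unique)
  then show ?thesis
    using \<open>t > 0\<close> by simp
qed (simp add: convol_def)

lemma continuous_on_convol_mean:
  assumes "continuous_on {0..} g"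
  shows "continuous_on {0..} (convol_mean g)"
proof -
  have "continuous_on ({0..} \<times> cbox 0 1) (\<lambda>(t, r). P (t * (1 - r)) (g (t * r)))"
    unfolding case_prod_beta
    by (intro continuous_intros continuous_on_compose2[OF assms]) auto
  from integral_continuous_on_param[OF this] show ?thesis
    by (simp add: convol_mean_def[abs_def])
qed

lemma continuous_on_convol:
  assumes "continuous_on {0..} g"
  shows "continuous_on {0..} (convol g)"
proof -
  have "continuous_on {0..} (\<lambda>t. t *\<^sub>R convol_mean g t)"
    by (intro continuous_intros continuous_on_convol_mean assms)
  then show ?thesis
    by (rule continuous_on_eq) (simp add: convol_eq_mean assms)
qed

lemma tendsto_convol_mean_0:
  assumes "continuous_on {0..} g"
  shows "(convol_mean g \<longlongrightarrow> g 0) (at_right 0)"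
proof -
  have "(convol_mean g \<longlongrightarrow> convol_mean g 0) (at 0 within {0..})"
    using continuous_on_convol_mean[OF assms] by (auto simp: continuous_on_def)
  moreover have "convol_mean g 0 = g 0"
    by (simp add: convol_mean_def)
  ultimately show ?thesis
    by (metis tendsto_within_subset greaterThan_subset_iff atLeast_subset_iff Ioi_le_Ico)
qed

end

lemma has_integral_exp:
  assumes "b \<noteq> 0" "t \<ge> (0::real)"
  shows "((\<lambda>s. exp (b * s)) has_integral (exp (b * t) - 1) / b) {0..t}"
proof -
  have "((\<lambda>s. exp (b * s)) has_integral exp (b * t) / b - exp (b * 0) / b) {0..t}"
    using assms
    by (intro fundamental_theorem_of_calculus)
      (auto intro!: derivative_eq_intros simp: has_real_derivative_iff_has_vector_derivative[symmetric])
  then show ?thesis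
    by (simp add: diff_divide_distrib)
qed

lemma add_norm_nonneg: "0 \<le> f x + norm f" for f :: "'a::topological_space \<Rightarrow>\<^sub>C real"
  using neg_norm_le_apply[of f x] by linarith

context markov
begin

lemma norm_convol_le:
  assumes g: "continuous_on {0..} g" and "t \<ge> 0" and "b > 0" "M \<ge> 0"
    and bd: "\<And>s. s \<ge> 0 \<Longrightarrow> norm (g s) \<le> M * exp (b * s)"
  shows "norm (convol g t) \<le> M / b * exp (b * t)"
proof -
  have e: "((\<lambda>s. M * exp (b * s)) has_integral M * ((exp (b * t) - 1) / b)) {0..t}"
    using assms by (intro has_integral_mult_right has_integral_exp) auto
  have "norm (integral {0..t} (\<lambda>s. P (t - s) (g s))) \<le> integral {0..t} (\<lambda>s. M * exp (b * s))"
  proof (rule integral_norm_bound_integral)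
    show "(\<lambda>s. P (t - s) (g s)) integrable_on {0..t}" "(\<lambda>s. M * exp (b * s)) integrable_on {0..t}"
      using has_integral_convol[OF g \<open>t \<ge> 0\<close>] e by auto
    show "norm (P (t - s) (g s)) \<le> M * exp (b * s)" if "s \<in> {0..t}" for s
      using norm_P_le[of "t - s" "g s"] bd[of s] that by auto
  qed
  also have "\<dots> = M * ((exp (b * t) - 1) / b)"
    using e by (rule integral_unique)
  also have "\<dots> \<le> M / b * exp (b * t)"
    using assms by (simp add: field_simps)
  finally show ?thesis
    by (simp add: convol_def)
qed

lemma convol_diff:
  assumes g: "continuous_on {0..} g" and h: "continuous_on {0..} h" and t: "t \<ge> 0"
  shows "convol (\<lambda>s. g s - h s) t = convol g t - convol h t"
proof -
  have "((\<lambda>s. P (t - s) (g s) - P (t - s) (h s)) has_integral convol g t - convol h t) {0..t}"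
    by (intro has_integral_diff has_integral_convol assms)
  then have "((\<lambda>s. P (t - s) (g s - h s)) has_integral convol g t - convol h t) {0..t}"
    by (rule has_integral_eq[rotated]) (simp add: P_linear)
  then show ?thesis
    unfolding convol_def[of "\<lambda>s. g s - h s"] by (rule integral_unique)
qed

lemma duhamel_solution_convol:
  assumes "duhamel_solution P V f u" "t \<ge> 0"
  shows "u t = P t f + convol (\<lambda>s. bc_mult V (u s)) t"
proof -
  have "((\<lambda>s. P (t - s) (bc_mult V (u s))) has_integral (u t - P t f)) {0..t}"
    using assms by (simp add: duhamel_solution_def)
  then show ?thesis
    unfolding convol_def by (simp add: integral_unique)
qed

lemma duhamel_solution_continuous: "duhamel_solution P V f u \<Longrightarrow> continuous_on {0..} u"
  by (simp add: duhamel_solution_def)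

lemma duhamel_solution_0 [simp]: "duhamel_solution P V f u \<Longrightarrow> u 0 = f"
  using duhamel_solution_convol[of V f u 0] by (simp add: convol_def)

lemma duhamel_solution_diff:
  assumes "duhamel_solution P V f u" "duhamel_solution P V g v"
  shows "duhamel_solution P V (f - g) (\<lambda>t. u t - v t)"
  unfolding duhamel_solution_def
proof (intro conjI allI impI)
  show "continuous_on {0..} (\<lambda>t. u t - v t)"
    using assms by (intro continuous_intros duhamel_solution_continuous)
  fix t :: real assume t: "t \<ge> 0"
  have "((\<lambda>s. P (t - s) (bc_mult V (u s)) - P (t - s) (bc_mult V (v s))) has_integral
      (u t - P t f) - (v t - P t g)) {0..t}"
    using assms t unfolding duhamel_solution_def by (intro has_integral_diff) auto
  then have "((\<lambda>s. P (t - s) (bc_mult V (u s - v s))) has_integral (u t - P t f) - (v t - P t g)) {0..t}"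
    by (rule has_integral_eq[rotated]) (simp add: P_linear bc_mult.diff_right)
  then show "((\<lambda>s. P (t - s) (bc_mult V (u s - v s))) has_integral u t - v t - P t (f - g)) {0..t}"
    using t by (simp add: P_linear algebra_simps)
qed

lemma duhamel_solution_scaleR:
  assumes "duhamel_solution P V f u"
  shows "duhamel_solution P V (c *\<^sub>R f) (\<lambda>t. c *\<^sub>R u t)"
  unfolding duhamel_solution_def
proof (intro conjI allI impI)
  show "continuous_on {0..} (\<lambda>t. c *\<^sub>R u t)"
    using assms by (intro continuous_intros duhamel_solution_continuous)
  fix t :: real assume t: "t \<ge> 0"
  have "((\<lambda>s. c *\<^sub>R P (t - s) (bc_mult V (u s))) has_integral c *\<^sub>R (u t - P t f)) {0..t}"
    using assms t unfolding duhamel_solution_def by (intro has_integral_cmul) auto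
  then have "((\<lambda>s. P (t - s) (bc_mult V (c *\<^sub>R u s))) has_integral c *\<^sub>R (u t - P t f)) {0..t}"
    by (rule has_integral_eq[rotated]) (simp add: P_linear bc_mult.scaleR_right)
  then show "((\<lambda>s. P (t - s) (bc_mult V (c *\<^sub>R u s))) has_integral c *\<^sub>R u t - P t (c *\<^sub>R f)) {0..t}"
    using t by (simp add: P_linear algebra_simps)
qed

text \<open>
  A constant can be moved between potential and solution.  This reduces positivity and the
  comparison with \<open>P\<close> to potentials of one sign.  The semigroup law turns
  \<open>z s = P (t - s) (u s)\<close> into an ordinary integral with fixed integrand, so \<open>exp (c * s) *\<^sub>R z s\<close> can be differentiated even though \<open>u\<close> itself need
  not be differentiable; its derivative is the integrand of the shifted equation.
\<close>
lemma duhamel_solution_shift: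
  assumes u: "duhamel_solution P V f u"
  shows "duhamel_solution P (V + const_bcontfun c) f (\<lambda>t. exp (c * t) *\<^sub>R u t)"
  unfolding duhamel_solution_def
proof (intro conjI allI impI)
  note cont = duhamel_solution_continuous[OF u]
  show "continuous_on {0..} (\<lambda>t. exp (c * t) *\<^sub>R u t)"
    by (intro continuous_intros cont)
  fix t :: real assume t: "t \<ge> 0"
  define k where "k = (\<lambda>r. P (t - r) (bc_mult V (u r)))"
  define z where "z = (\<lambda>s. P (t - s) (u s))"
  have k_cont: "continuous_on {0..t} k"
    unfolding k_def
    by (intro convol_integrand_continuous bc_mult.continuous_on continuous_intros cont t)
  have z_eq: "z s = P t f + integral {0..s} k" if "s \<in> {0..t}" for s
  proof -
    have "((\<lambda>r. P (s - r) (bc_mult V (u r))) has_integral (u s - P s f)) {0..s}"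
      using u that unfolding duhamel_solution_def by auto
    then have "((\<lambda>r. P (t - s) (P (s - r) (bc_mult V (u r)))) has_integral P (t - s) (u s - P s f)) {0..s}"
      by (rule has_integral_P) (use that in auto)
    then have "(k has_integral P (t - s) (u s - P s f)) {0..s}"
    proof (rule has_integral_eq[rotated])
      fix r assume "r \<in> {0..s}"
      then show "P (t - s) (P (s - r) (bc_mult V (u r))) = k r"
        using that P_add[of "t - s" "s - r" "bc_mult V (u r)"] by (simp add: k_def)
    qed
    moreover have "P (t - s) (u s - P s f) = z s - P t f"
      using that P_add[of "t - s" s f] by (simp add: z_def P_linear)
    ultimately have "integral {0..s} k = z s - P t f"
      using integral_unique by metis
    then show ?thesis by simp
  qed
  have "(z has_vector_derivative k s) (at s within {0..t})" if "s \<in> {0..t}" for s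
  proof -
    have "((\<lambda>s. P t f + integral {0..s} k) has_vector_derivative 0 + k s) (at s within {0..t})"
      by (intro has_vector_derivative_add has_vector_derivative_const
          integral_has_vector_derivative k_cont that)
    then have "((\<lambda>s. P t f + integral {0..s} k) has_vector_derivative k s) (at s within {0..t})"
      by simp
    then show ?thesis
      by (rule has_vector_derivative_transform[OF that, rotated]) (rule z_eq)
  qed
  then have "((\<lambda>s. exp (c * s) *\<^sub>R z s) has_vector_derivative
      exp (c * s) *\<^sub>R k s + (c * exp (c * s)) *\<^sub>R z s) (at s within {0..t})" if "s \<in> {0..t}" for s
    using that by (intro has_vector_derivative_scaleR) (auto intro!: derivative_eq_intros)
  then have "((\<lambda>s. exp (c * s) *\<^sub>R k s + (c * exp (c * s)) *\<^sub>R z s) has_integral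
      (exp (c * t) *\<^sub>R z t - exp (c * 0) *\<^sub>R z 0)) {0..t}"
    using t by (intro fundamental_theorem_of_calculus) auto
  then have "((\<lambda>s. P (t - s) (bc_mult (V + const_bcontfun c) (exp (c * s) *\<^sub>R u s))) has_integral
      (exp (c * t) *\<^sub>R z t - exp (c * 0) *\<^sub>R z 0)) {0..t}"
  proof (rule has_integral_eq[rotated])
    fix s assume s: "s \<in> {0..t}"
    have "bc_mult (V + const_bcontfun c) (exp (c * s) *\<^sub>R u s) =
        exp (c * s) *\<^sub>R bc_mult V (u s) + (c * exp (c * s)) *\<^sub>R u s"
      by (rule bcontfun_eqI) (simp add: algebra_simps)
    then show "exp (c * s) *\<^sub>R k s + (c * exp (c * s)) *\<^sub>R z s =
        P (t - s) (bc_mult (V + const_bcontfun c) (exp (c * s) *\<^sub>R u s))"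
      using s by (simp add: P_linear k_def z_def)
  qed
  then show "((\<lambda>s. P (t - s) (bc_mult (V + const_bcontfun c) (exp (c * s) *\<^sub>R u s))) has_integral
      exp (c * t) *\<^sub>R u t - P t f) {0..t}"
    by (simp add: z_def duhamel_solution_0[OF u])
qed

text \<open>
  The equation improves lower bounds: from \<open>u s \<ge> - N exp (b s)\<close> it follows that
  \<open>u s \<ge> - (N / 2) exp (b s)\<close> as soon as the rate \<open>b\<close> exceeds \<open>2 * norm V\<close>.  Some \<open>N\<close> exists by
  compactness of \<open>[0,a]\<close>, and iterating sends it to \<open>0\<close>.
\<close>
lemma duhamel_solution_nonneg_if_potential_nonneg:
  assumes u: "duhamel_solution P V f u"
    and V: "\<And>x. apply_bcontfun V x \<ge> 0" and f: "\<And>x. apply_bcontfun f x \<ge> 0" and a: "a \<ge> 0"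
  shows "u a x \<ge> 0"
proof -
  define b where "b = 2 * norm V + 1"
  have b: "b > 0" unfolding b_def by (simp add: add_nonneg_pos)
  \<comment> \<open>One pass through the equation halves the bound, because \<open>norm V / b < 1 / 2\<close>.\<close>
  have half: "u s x \<ge> - (N / 2) * exp (b * s)"
    if N: "N \<ge> 0" and lower: "\<And>s x. s \<in> {0..a} \<Longrightarrow> u s x \<ge> - N * exp (b * s)" and s: "s \<in> {0..a}"
    for N s x
  proof -
    have "((\<lambda>r. P (s - r) (bc_mult V (u r))) has_integral (u s - P s f)) {0..s}"
      using u s unfolding duhamel_solution_def by auto
    from has_integral_linear[OF this bounded_linear_eval[of x]]
    have 1: "((\<lambda>r. P (s - r) (bc_mult V (u r)) x) has_integral (u s x - P s f x)) {0..s}"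
      by (simp add: o_def)
    have 2: "((\<lambda>r. - (norm V * N) * exp (b * r)) has_integral - (norm V * N) * ((exp (b * s) - 1) / b)) {0..s}"
      using s b by (intro has_integral_mult_right has_integral_exp) auto
    have "- (norm V * N) * ((exp (b * s) - 1) / b) \<le> u s x - P s f x"
    proof (rule has_integral_le[OF 2 1])
      fix r assume r: "r \<in> {0..s}"
      have "P (s - r) (const_bcontfun (- (norm V * N) * exp (b * r))) x \<le> P (s - r) (bc_mult V (u r)) x"
      proof (rule P_mono)
        fix y
        have "V y * (- N * exp (b * r)) \<le> V y * u r y"
          using lower[of r y] r s V by (intro mult_left_mono) auto
        moreover have "V y * (N * exp (b * r)) \<le> norm V * (N * exp (b * r))"
          using N by (intro mult_right_mono apply_le_norm) auto
        ultimately show "const_bcontfun (- (norm V * N) * exp (b * r)) y \<le> bc_mult V (u r) y"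
          by (simp add: mult_ac)
      qed (use r in auto)
      then show "- (norm V * N) * exp (b * r) \<le> P (s - r) (bc_mult V (u r)) x"
        using r by (simp add: P_const)
    qed
    moreover have "norm V * N * ((exp (b * s) - 1) / b) \<le> N / 2 * exp (b * s)"
    proof -
      have "2 * norm V * (exp (b * s) - 1) \<le> b * exp (b * s)"
        unfolding b_def by (simp add: algebra_simps add_increasing)
      then have "norm V * ((exp (b * s) - 1) / b) \<le> exp (b * s) / 2"
        using b by (simp add: field_simps)
      from mult_left_mono[OF this N] show ?thesis
        by (simp add: mult_ac)
    qed
    moreover have "P s f x \<ge> 0"
      using f s by (intro P_nonneg) auto
    ultimately show ?thesis by simp
  qed
  have "compact (u ` {0..a})"
    by (intro compact_continuous_image continuous_on_subset[OF duhamel_solution_continuous[OF u]]) auto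
  then obtain B where B: "B > 0" "\<And>s. s \<in> {0..a} \<Longrightarrow> norm (u s) \<le> B"
    by (metis compact_imp_bounded bounded_pos imageI)
  have "\<forall>s\<in>{0..a}. \<forall>x. u s x \<ge> - (B / 2 ^ n) * exp (b * s)" for n
  proof (induction n)
    case 0
    have "- (B * exp (b * s)) \<le> u s x" if "s \<in> {0..a}" for s x
    proof -
      have "B * 1 \<le> B * exp (b * s)"
        using B b that by (intro mult_left_mono) auto
      then show ?thesis
        using B(2)[OF that] neg_norm_le_apply[of "u s" x] by linarith
    qed
    then show ?case by simp
  next
    case (Suc n)
    then show ?case
      using half[of "B / 2 ^ n"] B by (simp add: field_simps)
  qed
  then have "- u a x \<le> B * exp (b * a) * (1 / 2) ^ n" for n
  proof -
    have "- (B / 2 ^ n) * exp (b * a) \<le> u a x"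
      using \<open>\<And>n. \<forall>s\<in>{0..a}. \<forall>x. u s x \<ge> - (B / 2 ^ n) * exp (b * s)\<close> a by simp
    then show ?thesis
      by (simp add: power_divide)
  qed
  then have "- u a x \<le> 0"
    by (rule le_0_of_geometric) auto
  then show ?thesis by simp
qed

lemma duhamel_solution_nonneg:
  assumes u: "duhamel_solution P V f u" and f: "\<And>x. apply_bcontfun f x \<ge> 0" and t: "t \<ge> 0"
  shows "u t x \<ge> 0"
proof -
  have "(exp (norm V * t) *\<^sub>R u t) x \<ge> 0"
    by (rule duhamel_solution_nonneg_if_potential_nonneg[OF duhamel_solution_shift[OF u, of "norm V"]])
      (use f t add_norm_nonneg[of V] in auto)
  then show ?thesis
    by (simp add: zero_le_mult_iff)
qed

text \<open>The difference of two solutions starts at \<open>0\<close>, so positivity applies to it and to its negative.\<close>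
lemma duhamel_solution_unique:
  assumes "duhamel_solution P V f u" "duhamel_solution P V f v" "t \<ge> 0"
  shows "u t = v t"
proof (rule bcontfun_eqI)
  fix x
  have "(u t - v t) x \<ge> 0" "(v t - u t) x \<ge> 0"
    using duhamel_solution_nonneg[OF duhamel_solution_diff[OF assms(1,2)] _ assms(3)]
      duhamel_solution_nonneg[OF duhamel_solution_diff[OF assms(2,1)] _ assms(3)] by simp_all
  then show "u t x = v t x" by simp
qed

text \<open>
  Banach's fixed point theorem on the space of bounded continuous curves.  The weight \<open>exp (- b * t)\<close>
  makes the Duhamel map a contraction on the whole half-line at once, so that no local solutions have
  to be glued.  Curves live on the whole real line, hence the clamp \<open>max 0 t\<close>.
\<close>
lemma duhamel_solution_exists: "\<exists>u. duhamel_solution P V f u"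
proof -
  define b where "b = 2 * norm V + 1"
  have b: "b > 0"
    unfolding b_def using norm_ge_zero[of V] by linarith
  then have Vb: "norm V / b \<le> 1 / 2"
    by (simp add: b_def field_simps)
  define src where "src = (\<lambda>(w :: real \<Rightarrow>\<^sub>C ('a \<Rightarrow>\<^sub>C real)) s. exp (b * s) *\<^sub>R bc_mult V (w s))"
  define \<Phi> where "\<Phi> = (\<lambda>w t. exp (- b * max 0 t) *\<^sub>R (P (max 0 t) f + convol (src w) (max 0 t)))"
  have src_cont: "continuous_on A (src w)" for A w
    unfolding src_def by (intro continuous_intros bc_mult.continuous_on) auto
  have norm_src: "norm (src w s - src w' s) \<le> norm V * norm (w - w') * exp (b * s)" for w w' s
  proof -
    have "src w s - src w' s = exp (b * s) *\<^sub>R bc_mult V ((w - w') s)"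
      by (simp add: src_def bc_mult.diff_right scaleR_diff_right)
    moreover have "norm (bc_mult V ((w - w') s)) \<le> norm V * norm (w - w')"
      by (rule order_trans[OF norm_bc_mult_le mult_left_mono]) (use norm_bounded[of "w - w'" s] in auto)
    ultimately show ?thesis
      by (simp add: mult_ac)
  qed
  have lip: "norm (\<Phi> w t - \<Phi> w' t) \<le> 1 / 2 * norm (w - w')" for w w' t
  proof -
    define \<tau> where "\<tau> = max 0 t"
    have "\<tau> \<ge> 0" by (simp add: \<tau>_def)
    have eq: "\<Phi> w t - \<Phi> w' t = exp (- b * \<tau>) *\<^sub>R convol (\<lambda>s. src w s - src w' s) \<tau>"
      using \<open>\<tau> \<ge> 0\<close> by (simp add: \<Phi>_def convol_diff src_cont algebra_simps flip: \<tau>_def)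
    have "norm (convol (\<lambda>s. src w s - src w' s) \<tau>) \<le> norm V * norm (w - w') / b * exp (b * \<tau>)"
      by (rule norm_convol_le) (use \<open>\<tau> \<ge> 0\<close> b norm_src in \<open>auto intro!: continuous_intros src_cont\<close>)
    then have "exp (- b * \<tau>) * norm (convol (\<lambda>s. src w s - src w' s) \<tau>) \<le>
        exp (- b * \<tau>) * (norm V * norm (w - w') / b * exp (b * \<tau>))"
      by (rule mult_left_mono) simp
    then have "norm (\<Phi> w t - \<Phi> w' t) \<le> exp (- b * \<tau>) * (norm V * norm (w - w') / b * exp (b * \<tau>))"
      unfolding eq by simp
    also have "\<dots> = norm V / b * norm (w - w')"
      by (simp add: exp_minus field_simps)
    also have "\<dots> \<le> 1 / 2 * norm (w - w')"
      using Vb by (intro mult_right_mono) auto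
    finally show ?thesis .
  qed
  have \<Phi>_0: "norm (\<Phi> 0 t) \<le> norm f" for t
  proof -
    have "convol (src 0) (max 0 t) = integral {0..max 0 t} (\<lambda>s. 0)"
      unfolding convol_def by (rule integral_cong) (simp add: src_def bc_mult.zero_right P_linear)
    then have "convol (src 0) (max 0 t) = 0" by simp
    moreover have "exp (- b * max 0 t) * norm (P (max 0 t) f) \<le> 1 * norm f"
      using b by (intro mult_mono norm_P_le) auto
    ultimately show ?thesis
      by (simp add: \<Phi>_def)
  qed
  have "\<exists>w'. \<forall>t. apply_bcontfun w' t = \<Phi> w t" for w
  proof -
    have "continuous_on UNIV (\<Phi> w)"
      unfolding \<Phi>_def
      by (intro continuous_intros continuous_on_compose2[OF continuous_on_convol[OF src_cont]]) auto
    moreover have "norm (\<Phi> w t) \<le> norm f + 1 / 2 * norm w" for t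
      using \<Phi>_0[of t] lip[of w t 0] norm_triangle_ineq[of "\<Phi> 0 t" "\<Phi> w t - \<Phi> 0 t"] by simp
    ultimately have "\<Phi> w \<in> bcontfun"
      by (rule bcontfun_normI)
    then show ?thesis
      by (metis Bcontfun_inverse)
  qed
  then obtain \<Psi> where \<Psi>: "\<And>w t. apply_bcontfun (\<Psi> w) t = \<Phi> w t"
    by metis
  have "\<exists>!w. \<Psi> w = w"
  proof (rule banach_fix_type[of "1 / 2"])
    show "\<forall>w w'. dist (\<Psi> w) (\<Psi> w') \<le> 1 / 2 * dist w w'"
      unfolding dist_norm
    proof (intro allI)
      fix w w'
      show "norm (\<Psi> w - \<Psi> w') \<le> 1 / 2 * norm (w - w')"
        by (rule norm_bound) (use lip[of w _ w'] in \<open>simp add: \<Psi>\<close>)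
    qed
  qed auto
  then obtain w where w: "\<And>t. apply_bcontfun w t = \<Phi> w t"
    using \<Psi> by metis
  define u where "u = (\<lambda>t. exp (b * t) *\<^sub>R w t)"
  have src_w: "src w = (\<lambda>s. bc_mult V (u s))"
    by (simp add: src_def u_def bc_mult.scaleR_right)
  have "u t = P t f + convol (src w) t" if "t \<ge> 0" for t
    using that w[of t] by (simp add: u_def \<Phi>_def exp_minus)
  then have "duhamel_solution P V f u"
    unfolding duhamel_solution_def src_w
    using has_integral_convol[OF src_cont[of _ w]]
    by (auto simp: u_def src_w intro!: continuous_intros)
  then show ?thesis by blast
qed

section \<open>The Schrodinger semigroup\<close>

lemma schrodinger_eqI:
  assumes "duhamel_solution P V f u" "t \<ge> 0"
  shows "schrodinger P V t f = u t"
  unfolding schrodinger_def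
  by (rule the_equality) (use assms duhamel_solution_unique in blast)+

lemma duhamel_solution_schrodinger: "duhamel_solution P V f (\<lambda>t. schrodinger P V t f)"
proof -
  obtain u where u: "duhamel_solution P V f u"
    using duhamel_solution_exists by blast
  then have eq: "schrodinger P V t f = u t" if "t \<ge> 0" for t
    using schrodinger_eqI that by blast
  show ?thesis
    unfolding duhamel_solution_def
  proof (intro conjI allI impI)
    show "continuous_on {0..} (\<lambda>t. schrodinger P V t f)"
      using duhamel_solution_continuous[OF u] by (rule continuous_on_eq) (simp add: eq)
    fix t :: real assume t: "t \<ge> 0"
    have "((\<lambda>s. P (t - s) (bc_mult V (u s))) has_integral (u t - P t f)) {0..t}"
      using u t by (simp add: duhamel_solution_def)
    then show "((\<lambda>s. P (t - s) (bc_mult V (schrodinger P V s f))) has_integral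
        schrodinger P V t f - P t f) {0..t}"
      by (subst eq[OF t]) (rule has_integral_eq[rotated], auto simp: eq)
  qed
qed

lemma schrodinger_0 [simp]: "schrodinger P V 0 f = f"
  using duhamel_solution_0[OF duhamel_solution_schrodinger] .

lemma schrodinger_linear:
  assumes "t \<ge> 0"
  shows "linear (schrodinger P V t)"
proof -
  have diff: "schrodinger P V t (f - g) = schrodinger P V t f - schrodinger P V t g" for f g
    by (intro schrodinger_eqI duhamel_solution_diff duhamel_solution_schrodinger assms)
  have scale: "schrodinger P V t (c *\<^sub>R f) = c *\<^sub>R schrodinger P V t f" for c f
    by (intro schrodinger_eqI duhamel_solution_scaleR duhamel_solution_schrodinger assms)
  show ?thesis
  proof (rule linearI[OF _ scale])
    fix f g
    show "schrodinger P V t (f + g) = schrodinger P V t f + schrodinger P V t g"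
      using diff[of f "(-1) *\<^sub>R g"] scale[of "-1" g] by simp
  qed
qed

lemma schrodinger_nonneg:
  assumes "t \<ge> 0" "\<And>x. apply_bcontfun f x \<ge> 0"
  shows "schrodinger P V t f x \<ge> 0"
  using duhamel_solution_nonneg[OF duhamel_solution_schrodinger] assms by blast

lemma schrodinger_shift:
  assumes "t \<ge> 0"
  shows "schrodinger P (V + const_bcontfun c) t f = exp (c * t) *\<^sub>R schrodinger P V t f"
  by (intro schrodinger_eqI duhamel_solution_shift duhamel_solution_schrodinger assms)

text \<open>
  The integral in Duhamel's equation has the sign of the potential, because the solution is nonnegative.
\<close>
lemma schrodinger_compare_free:
  assumes t: "t \<ge> 0" and f: "\<And>x. apply_bcontfun f x \<ge> 0"
  shows "(\<And>x. apply_bcontfun V x \<ge> 0) \<Longrightarrow> P t f x \<le> schrodinger P V t f x"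
    and "(\<And>x. apply_bcontfun V x \<le> 0) \<Longrightarrow> schrodinger P V t f x \<le> P t f x"
proof -
  define u where "u = (\<lambda>t. schrodinger P V t f)"
  have u: "duhamel_solution P V f u"
    unfolding u_def by (rule duhamel_solution_schrodinger)
  have u_nonneg: "u s x \<ge> 0" if "s \<ge> 0" for s x
    using duhamel_solution_nonneg[OF u f that] .
  have "((\<lambda>s. P (t - s) (bc_mult V (u s))) has_integral (u t - P t f)) {0..t}"
    using u t unfolding duhamel_solution_def by auto
  from has_integral_linear[OF this bounded_linear_eval[of x]]
  have int: "((\<lambda>s. P (t - s) (bc_mult V (u s)) x) has_integral (u t x - P t f x)) {0..t}"
    by (simp add: o_def)
  show "P t f x \<le> schrodinger P V t f x" if "\<And>x. V x \<ge> 0"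
  proof -
    have "P (t - s) (bc_mult V (u s)) x \<ge> 0" if "s \<in> {0..t}" for s
      using that u_nonneg \<open>\<And>x. V x \<ge> 0\<close> by (intro P_nonneg) auto
    then have "0 \<le> u t x - P t f x"
      by (rule has_integral_nonneg[OF int])
    then show ?thesis by (simp add: u_def)
  qed
  show "schrodinger P V t f x \<le> P t f x" if "\<And>x. V x \<le> 0"
  proof -
    have "P (t - s) (bc_mult V (u s)) x \<le> 0" if "s \<in> {0..t}" for s
    proof -
      have "P (t - s) (bc_mult V (u s)) x \<le> P (t - s) 0 x"
        using that u_nonneg \<open>\<And>x. V x \<le> 0\<close> by (intro P_mono) (auto simp: mult_nonpos_nonneg)
      then show ?thesis using that by (simp add: P_linear)
    qed
    then have "u t x - P t f x \<le> 0"
      by (intro has_integral_le[OF int has_integral_0])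
    then show ?thesis by (simp add: u_def)
  qed
qed

text \<open>Shifting \<open>V\<close> by \<open>\<plusminus> norm V\<close> gives it a sign.\<close>
lemma schrodinger_bounds:
  assumes t: "t \<ge> 0" and f: "\<And>x. apply_bcontfun f x \<ge> 0"
  shows "exp (- norm V * t) * P t f x \<le> schrodinger P V t f x"
    and "schrodinger P V t f x \<le> exp (norm V * t) * P t f x"
proof -
  have "P t f x \<le> schrodinger P (V + const_bcontfun (norm V)) t f x"
    by (intro schrodinger_compare_free t f) (simp add: add_norm_nonneg)
  then show "exp (- norm V * t) * P t f x \<le> schrodinger P V t f x"
    using t by (simp add: schrodinger_shift exp_minus field_simps)
  have "schrodinger P (V + const_bcontfun (- norm V)) t f x \<le> P t f x"
    using apply_le_norm[of V] by (intro schrodinger_compare_free t f) simp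
  then show "schrodinger P V t f x \<le> exp (norm V * t) * P t f x"
    using t by (simp add: schrodinger_shift exp_minus field_simps)
qed

lemma schrodinger_add:
  assumes s: "s \<ge> 0" and t: "t \<ge> 0"
  shows "schrodinger P V (s + t) f = schrodinger P V t (schrodinger P V s f)"
proof -
  define u where "u = (\<lambda>t. schrodinger P V t f)"
  have u: "duhamel_solution P V f u"
    unfolding u_def by (rule duhamel_solution_schrodinger)
  note cont = duhamel_solution_continuous[OF u]
  have "duhamel_solution P V (u s) (\<lambda>t. u (s + t))"
    unfolding duhamel_solution_def
  proof (intro conjI allI impI)
    show "continuous_on {0..} (\<lambda>t. u (s + t))"
      by (intro continuous_on_compose2[OF cont] continuous_intros) (use s in auto)
    fix t :: real assume t: "t \<ge> 0"
    define F where "F = (\<lambda>r. P (s + t - r) (bc_mult V (u r)))"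
    have whole: "(F has_integral (u (s + t) - P (s + t) f)) {0..s + t}"
      using u s t unfolding duhamel_solution_def F_def by auto
    have "((\<lambda>r. P (s - r) (bc_mult V (u r))) has_integral (u s - P s f)) {0..s}"
      using u s unfolding duhamel_solution_def by auto
    then have "((\<lambda>r. P t (P (s - r) (bc_mult V (u r)))) has_integral P t (u s - P s f)) {0..s}"
      using t by (rule has_integral_P)
    then have left: "(F has_integral P t (u s - P s f)) {0..s}"
    proof (rule has_integral_eq[rotated])
      fix r assume "r \<in> {0..s}"
      then show "P t (P (s - r) (bc_mult V (u r))) = F r"
        using t P_add[of t "s - r" "bc_mult V (u r)"] by (simp add: F_def algebra_simps)
    qed
    have "F integrable_on {s..s + t}"
      using s t by (intro integrable_subinterval_real[OF has_integral_integrable[OF whole]]) auto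
    then obtain I where I: "(F has_integral I) {s..s + t}"
      by blast
    have "(F has_integral (P t (u s - P s f) + I)) {0..s + t}"
      by (rule has_integral_combine[OF _ _ left I]) (use s t in auto)
    then have "P t (u s - P s f) + I = u (s + t) - P (s + t) f"
      using whole by (rule has_integral_unique)
    then have "I = u (s + t) - P t (u s)"
      using P_add[OF t s, of f] s t by (simp add: P_linear add.commute algebra_simps)
    then have "(F has_integral u (s + t) - P t (u s)) (cbox s (s + t))"
      using I by simp
    from has_integral_affinity'[OF this, of 1 s]
    show "((\<lambda>r. P (t - r) (bc_mult V (u (s + r)))) has_integral u (s + t) - P t (u s)) {0..t}"
      by (simp add: F_def add.commute)
  qed
  from schrodinger_eqI[OF this t] show ?thesis
    by (simp add: u_def)
qed

lemma generator_tendsto: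
  assumes "f \<in> gen_domain P"
  shows "((\<lambda>t. (1 / t) *\<^sub>R (P t f - f)) \<longlongrightarrow> generator P f) (at_right 0)"
  using assms tendsto_Lim trivial_limit_at_right_real unfolding gen_domain_def generator_def by blast

text \<open>
  The generator of the Schrodinger semigroup extends \<open>L + V\<close>: the Duhamel term divided by \<open>t\<close> is the
  mean of an integrand that tends to \<open>V f\<close>.
\<close>
lemma schrodinger_generator_tendsto:
  assumes "f \<in> gen_domain P"
  shows "((\<lambda>t. (1 / t) *\<^sub>R (schrodinger P V t f - f)) \<longlongrightarrow> generator P f + bc_mult V f) (at_right 0)"
proof -
  define g where "g = (\<lambda>t. bc_mult V (schrodinger P V t f))"
  have g: "continuous_on {0..} g"
    unfolding g_def
    by (intro bc_mult.continuous_on continuous_intros duhamel_solution_continuous[OF duhamel_solution_schrodinger])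
  have "((\<lambda>t. (1 / t) *\<^sub>R (P t f - f) + convol_mean g t) \<longlongrightarrow> generator P f + g 0) (at_right 0)"
    by (intro tendsto_add generator_tendsto assms tendsto_convol_mean_0 g)
  moreover have "\<forall>\<^sub>F t in at_right 0. (1 / t) *\<^sub>R (P t f - f) + convol_mean g t =
      (1 / t) *\<^sub>R (schrodinger P V t f - f)"
    unfolding eventually_at_filter
  proof (rule always_eventually, intro allI impI)
    fix t :: real assume "t \<noteq> 0" "t \<in> {0<..}"
    then have "schrodinger P V t f = P t f + t *\<^sub>R convol_mean g t"
      using duhamel_solution_convol[OF duhamel_solution_schrodinger[of V f], of t] convol_eq_mean[OF g, of t]
      by (simp add: g_def)
    then show "(1 / t) *\<^sub>R (P t f - f) + convol_mean g t = (1 / t) *\<^sub>R (schrodinger P V t f - f)"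
      using \<open>t \<noteq> 0\<close> by (simp add: algebra_simps)
  qed
  ultimately show ?thesis
    using tendsto_cong by (fastforce simp: g_def)
qed

end

section \<open>Positive operators with a Harnack inequality\<close>

text \<open>
  Such operators map the positive functions into a set of bounded diameter for the Hilbert
  projective metric, which is what makes the Perron-Frobenius theory elementary.
\<close>

locale harnack_operator =
  fixes K :: "('a::metric_space \<Rightarrow>\<^sub>C real) \<Rightarrow> ('a \<Rightarrow>\<^sub>C real)" and d :: real
  assumes compact_UNIV: "compact (UNIV :: 'a set)"
    and linear: "linear K"
    and nonneg: "(\<And>x. apply_bcontfun f x \<ge> 0) \<Longrightarrow> K f x \<ge> 0"
    and K_1_pos: "K (const_bcontfun 1) x > 0"
    and d_pos: "d > 0"
    and harnack: "(\<And>x. apply_bcontfun f x \<ge> 0) \<Longrightarrow> d * K f y \<le> K f x"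
begin

lemmas K_simps = linear_add[OF linear] linear_diff[OF linear] linear_scale[OF linear] linear_neg[OF linear]

lemma mono: "(\<And>x. apply_bcontfun f x \<le> apply_bcontfun g x) \<Longrightarrow> K f x \<le> K g x"
  using nonneg[of "g - f" x] by (simp add: K_simps)

lemma pos:
  assumes "\<And>x. apply_bcontfun f x > 0"
  shows "K f x > 0"
proof -
  obtain m where m: "m > 0" "\<And>x. m \<le> f x"
    using positive_bounded_below[OF compact_UNIV assms] by blast
  have "K (m *\<^sub>R const_bcontfun 1) x \<le> K f x"
    by (rule mono) (use m in simp)
  then show ?thesis
    using m(1) mult_pos_pos[OF m(1) K_1_pos[of x]] by (simp add: K_simps)
qed

lemma d_le_1: "d \<le> 1"
  using harnack[of "const_bcontfun 1" undefined undefined] K_1_pos[of undefined] by simp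

lemma bounded_linear_K: "bounded_linear K"
proof (rule bounded_linear_intro[where K = "norm (K (const_bcontfun 1))"])
  fix f
  show "norm (K f) \<le> norm f * norm (K (const_bcontfun 1))"
  proof (rule norm_bound)
    fix x
    have "K f x \<le> K (norm f *\<^sub>R const_bcontfun 1) x" "K ((- norm f) *\<^sub>R const_bcontfun 1) x \<le> K f x"
      by (rule mono; simp add: apply_le_norm neg_norm_le_apply)+
    then have "norm (K f x) \<le> norm f * K (const_bcontfun 1) x"
      by (simp add: K_simps)
    also have "\<dots> \<le> norm f * norm (K (const_bcontfun 1))"
      by (intro mult_left_mono apply_le_norm) auto
    finally show "norm (K f x) \<le> norm f * norm (K (const_bcontfun 1))" .
  qed
qed (simp_all add: K_simps)

abbreviation "q \<equiv> 1 - d\<^sup>2"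

lemma q_bounds: "0 \<le> q" "q < 1"
  using d_pos d_le_1 by (simp_all add: power_le_one)

text \<open>
  Birkhoff's contraction.  If \<open>a g \<le> f \<le> b g\<close>, then \<open>f - a g\<close> and \<open>b g - f\<close> are nonnegative and add up
  to \<open>(b - a) g\<close>.  By the Harnack inequality the ratio of each image to \<open>K g\<close> is everywhere at least
  \<open>d\<^sup>2\<close> times its value at one point, and these two values add up to \<open>b - a\<close>.  Hence both bounds
  improve, by \<open>d\<^sup>2 (b - a)\<close> in total.
\<close>
lemma contraction:
  assumes g: "\<And>x. apply_bcontfun g x > 0"
    and f: "\<And>x. a * g x \<le> apply_bcontfun f x" "\<And>x. apply_bcontfun f x \<le> b * g x"
  obtains a' b' where "a \<le> a'" "b' - a' = q * (b - a)"
    "\<And>x. a' * K g x \<le> K f x" "\<And>x. K f x \<le> b' * K g x"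
proof -
  define x\<^sub>0 :: 'a where "x\<^sub>0 = undefined"
  have Kg: "K g x > 0" for x using g by (rule pos)
  \<comment> \<open>One factor \<open>d\<close> comes from the numerator \<open>K h\<close>, the other from the denominator \<open>K g\<close>.\<close>
  have improve: "d\<^sup>2 * (K h x\<^sub>0 / K g x\<^sub>0) * K g x \<le> K h x" if h: "\<And>x. apply_bcontfun h x \<ge> 0" for h x
  proof -
    have "d * K g x \<le> K g x\<^sub>0" "d * K h x\<^sub>0 \<le> K h x"
      using g h by (intro harnack; simp add: less_imp_le)+
    then have "(d * K g x) * (d * K h x\<^sub>0) \<le> K g x\<^sub>0 * K h x"
      by (intro mult_mono mult_nonneg_nonneg nonneg h) (use Kg[of x\<^sub>0] d_pos g in \<open>auto intro: less_imp_le\<close>)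
    then show ?thesis
      using Kg[of x\<^sub>0] by (simp add: field_simps power2_eq_square)
  qed
  define \<rho> where "\<rho> = K (f - a *\<^sub>R g) x\<^sub>0 / K g x\<^sub>0"
  define \<rho>' where "\<rho>' = K (b *\<^sub>R g - f) x\<^sub>0 / K g x\<^sub>0"
  show thesis
  proof (rule that[of "a + d\<^sup>2 * \<rho>" "b - d\<^sup>2 * \<rho>'"])
    have "K (f - a *\<^sub>R g) x\<^sub>0 \<ge> 0"
      using f by (intro nonneg) simp
    then show "a \<le> a + d\<^sup>2 * \<rho>"
      using Kg[of x\<^sub>0] by (simp add: \<rho>_def)
    have "\<rho> + \<rho>' = b - a"
      using Kg[of x\<^sub>0] by (simp add: \<rho>_def \<rho>'_def K_simps field_simps)
    then have "d\<^sup>2 * \<rho> + d\<^sup>2 * \<rho>' = d\<^sup>2 * (b - a)"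
      by (metis distrib_left)
    then show "(b - d\<^sup>2 * \<rho>') - (a + d\<^sup>2 * \<rho>) = q * (b - a)"
      by (simp add: left_diff_distrib)
    show "(a + d\<^sup>2 * \<rho>) * K g x \<le> K f x" for x
      using improve[of "f - a *\<^sub>R g" x] f(1) by (simp add: \<rho>_def K_simps algebra_simps)
    show "K f x \<le> (b - d\<^sup>2 * \<rho>') * K g x" for x
      using improve[of "b *\<^sub>R g - f" x] f(2) by (simp add: \<rho>'_def K_simps algebra_simps)
  qed
qed

text \<open>
  Applying \<open>K\<close> to two eigenvectors with the same eigenvalue does not change their ratio, yet contracts
  its oscillation.
\<close>
lemma eigenvector_unique:
  assumes \<psi>: "\<And>x. apply_bcontfun \<psi> x > 0" "K \<psi> = \<kappa> *\<^sub>R \<psi>" and f: "K f = \<kappa> *\<^sub>R f"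
  obtains c where "f = c *\<^sub>R \<psi>"
proof -
  obtain m where m: "m > 0" "\<And>x. m \<le> \<psi> x"
    using positive_bounded_below[OF compact_UNIV \<psi>(1)] by blast
  \<comment> \<open>The bounds \<open>- B \<psi> \<le> f \<le> B \<psi>\<close> start the iteration.\<close>
  define B where "B = norm f / m"
  have "\<kappa> * \<psi> undefined > 0"
    using pos[OF \<psi>(1), of undefined] \<psi>(2) by simp
  then have \<kappa>: "\<kappa> > 0"
    using \<psi>(1)[of undefined] by (simp add: zero_less_mult_iff)
  have "\<exists>a b. b - a = q ^ n * (2 * B) \<and> (\<forall>x. a * \<psi> x \<le> f x \<and> f x \<le> b * \<psi> x)" for n
  proof (induction n)
    case 0
    have "norm f \<le> B * \<psi> x" for x
      using m mult_left_mono[OF m(2)[of x], of "norm f"] by (simp add: B_def field_simps)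
    then have "- B * \<psi> x \<le> f x \<and> f x \<le> B * \<psi> x" for x
      using apply_le_norm[of f x] neg_norm_le_apply[of f x] by (smt (verit) mult_minus_left)
    then show ?case
      by (intro exI[of _ "- B"] exI[of _ B]) auto
  next
    case (Suc n)
    then obtain a b where ab: "b - a = q ^ n * (2 * B)"
      and bds: "\<And>x. a * \<psi> x \<le> f x" "\<And>x. f x \<le> b * \<psi> x"
      by blast
    obtain a' b' where "b' - a' = q * (b - a)"
      and "\<And>x. a' * K \<psi> x \<le> K f x" "\<And>x. K f x \<le> b' * K \<psi> x"
      using contraction[OF \<psi>(1) bds] by metis
    then have "b' - a' = q ^ Suc n * (2 * B)" "\<And>x. a' * \<psi> x \<le> f x" "\<And>x. f x \<le> b' * \<psi> x"
      using \<kappa> by (simp_all add: ab \<psi>(2) f mult.left_commute[of _ \<kappa>])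
    then show ?case by blast
  qed
  then have osc: "f x / \<psi> x - f y / \<psi> y \<le> (2 * B) * q ^ n" for x y n
  proof -
    obtain a b where ab: "b - a = q ^ n * (2 * B)"
      and bds: "\<And>x. a * \<psi> x \<le> f x" "\<And>x. f x \<le> b * \<psi> x"
      using \<open>\<And>n. \<exists>a b. b - a = q ^ n * (2 * B) \<and> (\<forall>x. a * \<psi> x \<le> f x \<and> f x \<le> b * \<psi> x)\<close> by blast
    have "f x / \<psi> x \<le> b" "a \<le> f y / \<psi> y"
      using bds \<psi>(1) by (simp_all add: field_simps)
    then show ?thesis
      using ab by (simp add: mult.commute)
  qed
  have le_0: "f x / \<psi> x - f y / \<psi> y \<le> 0" for x y
    by (rule le_0_of_geometric[OF osc q_bounds])
  define c where "c = f undefined / \<psi> undefined"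
  have "f x / \<psi> x = c" for x
    unfolding c_def using le_0[of x undefined] le_0[of undefined x] by simp
  then have "f x = c * \<psi> x" for x
    using \<psi>(1)[of x] by (metis less_irrefl nonzero_eq_divide_eq)
  then show thesis
    by (intro that[of c] bcontfun_eqI) simp
qed

text \<open>
  The eigenvector is the limit of the iterates \<open>K\<^sup>n 1\<close>, normalised to have value \<open>1\<close> at a fixed point.
  The contraction applied to the pair \<open>K\<^sup>n\<^sup>+\<^sup>1 1\<close>, \<open>K\<^sup>n 1\<close> shows that successive normalised iterates
  differ by a geometrically decreasing amount; the Harnack inequality bounds them from both sides.
\<close>
lemma eigenvector_exists:
  obtains \<psi> \<kappa> where "\<And>x. apply_bcontfun \<psi> x > 0" "\<kappa> > 0" "K \<psi> = \<kappa> *\<^sub>R \<psi>"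
proof -
  define x\<^sub>0 :: 'a where "x\<^sub>0 = undefined"
  define k where "k = (\<lambda>n. (K ^^ n) (const_bcontfun 1))"
  have k_Suc: "k (Suc n) = K (k n)" for n by (simp add: k_def)
  have k_pos: "k n x > 0" for n x
  proof (induction n arbitrary: x)
    case (Suc n)
    then show ?case unfolding k_Suc by (rule pos)
  qed (simp add: k_def)
  have k_harnack: "d * k n y \<le> k n x" for n x y
  proof (cases n)
    case 0
    then show ?thesis using d_le_1 by (simp add: k_def)
  next
    case (Suc m)
    then show ?thesis
      using harnack[of "k m"] k_pos by (simp add: k_Suc less_imp_le)
  qed
  obtain m where m: "m > 0" "\<And>x. m \<le> k 1 x"
    using positive_bounded_below[OF compact_UNIV k_pos] by blast
  define C where "C = norm (k 1) - m"
  have ratio: "\<exists>a b. m \<le> a \<and> b - a = q ^ n * C \<and> (\<forall>x. a * k n x \<le> k (Suc n) x \<and> k (Suc n) x \<le> b * k n x)" for n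
  proof (induction n)
    case 0
    show ?case
      using m(2) apply_le_norm[of "k 1"]
      by (intro exI[of _ m] exI[of _ "norm (k 1)"]) (simp add: C_def k_def)
  next
    case (Suc n)
    then obtain a b where ab: "m \<le> a" "b - a = q ^ n * C"
      and bds: "\<And>x. a * k n x \<le> k (Suc n) x" "\<And>x. k (Suc n) x \<le> b * k n x"
      by blast
    obtain a' b' where "a \<le> a'" "b' - a' = q * (b - a)"
      and "\<And>x. a' * K (k n) x \<le> K (k (Suc n)) x" "\<And>x. K (k (Suc n)) x \<le> b' * K (k n) x"
      using contraction[OF k_pos bds] by metis
    with ab show ?case
      by (intro exI[of _ a'] exI[of _ b']) (simp add: k_Suc)
  qed
  define e where "e = (\<lambda>n. (1 / k n x\<^sub>0) *\<^sub>R k n)"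
  have e_x0: "e n x\<^sub>0 = 1" for n
    using k_pos[of n x\<^sub>0] by (simp add: e_def)
  have e_lower: "d \<le> e n x" for n x
    using k_harnack[of n x\<^sub>0 x] k_pos[of n x\<^sub>0] by (simp add: e_def field_simps)
  have step: "norm (e (Suc n) - e n) \<le> C / (m * d) * q ^ n" for n
  proof (rule norm_bound)
    fix x
    define A A' B B' where "A = k n x" and "A' = k (Suc n) x" and "B = k n x\<^sub>0" and "B' = k (Suc n) x\<^sub>0"
    have pos: "A > 0" "B > 0" "B' > 0"
      by (simp_all add: A_def B_def B'_def k_pos)
    obtain a b where ab: "m \<le> a" "b - a = q ^ n * C"
      and bds: "a * A \<le> A'" "A' \<le> b * A" "a * B \<le> B'" "B' \<le> b * B"
      using ratio[of n] unfolding A_def A'_def B_def B'_def by blast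
    have dA: "d * A \<le> B"
      using k_harnack by (simp add: A_def B_def)
    have "a * A * B \<le> A' * B" "A' * B \<le> b * A * B" "a * B * A \<le> B' * A" "B' * A \<le> b * B * A"
      using bds pos by (simp_all add: mult_right_mono)
    then have "\<bar>A' * B - B' * A\<bar> \<le> (b - a) * (A * B)"
      by (simp add: algebra_simps abs_le_iff)
    then have "\<bar>A' * B - B' * A\<bar> / (B * B') \<le> (b - a) * (A * B) / (B * B')"
      using pos by (intro divide_right_mono) auto
    moreover have "A' / B' - A / B = (A' * B - B' * A) / (B * B')"
      using pos by (simp add: field_simps)
    ultimately have "\<bar>A' / B' - A / B\<bar> \<le> (b - a) * (A / B')"
      using pos by (simp add: abs_divide abs_mult)
    also have "\<dots> \<le> (b - a) * (1 / (m * d))"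
    proof (rule mult_left_mono)
      have "m * d * A \<le> m * B"
        using dA m(1) by simp
      also have "\<dots> \<le> a * B"
        using ab(1) pos by (simp add: mult_right_mono)
      also have "\<dots> \<le> B'" by (rule bds)
      finally show "A / B' \<le> 1 / (m * d)"
        using m(1) d_pos pos by (simp add: field_simps)
      have "a * A \<le> b * A" using bds by linarith
      then show "0 \<le> b - a" using pos by simp
    qed
    finally show "norm ((e (Suc n) - e n) x) \<le> C / (m * d) * q ^ n"
      by (simp add: e_def A_def A'_def B_def B'_def ab(2) mult.commute)
  qed
  have "summable (\<lambda>n. e (Suc n) - e n)"
  proof (rule summable_comparison_test')
    show "summable (\<lambda>n. C / (m * d) * q ^ n)"
      using q_bounds by (intro summable_mult summable_geometric) simp
    show "norm (e (Suc n) - e n) \<le> C / (m * d) * q ^ n" if "n \<ge> 0" for n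
      by (rule step)
  qed
  then have "convergent (\<lambda>n. \<Sum>i<n. e (Suc i) - e i)"
    by (simp add: summable_iff_convergent)
  then have "convergent (\<lambda>n. e n - e 0)"
    by (simp add: sum_lessThan_telescope)
  then have "convergent e"
    using convergent_add[OF _ convergent_const[of "e 0"], of "\<lambda>n. e n - e 0"] by simp
  then obtain \<psi> where \<psi>: "e \<longlonglongrightarrow> \<psi>"
    by (auto simp: convergent_def)
  have eval: "(\<lambda>n. f n x) \<longlonglongrightarrow> F x" if "f \<longlonglongrightarrow> F" for f and F :: "'a \<Rightarrow>\<^sub>C real" and x
    by (rule bounded_linear.tendsto[OF bounded_linear_eval that])
  have \<psi>_pos: "\<psi> x > 0" for x
    using LIMSEQ_le_const[OF eval[OF \<psi>], of d x] e_lower d_pos by fastforce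
  have Ke: "(\<lambda>n. K (e n)) \<longlonglongrightarrow> K \<psi>"
    by (rule bounded_linear.tendsto[OF bounded_linear_K \<psi>])
  define \<rho> where "\<rho> = (\<lambda>n. k (Suc n) x\<^sub>0 / k n x\<^sub>0)"
  have Ke_eq: "K (e n) = \<rho> n *\<^sub>R e (Suc n)" for n
    using k_pos[of "Suc n" x\<^sub>0] by (simp add: e_def \<rho>_def K_simps k_Suc)
  then have "K (e n) x\<^sub>0 = \<rho> n" for n
    by (simp add: e_x0)
  then have "\<rho> \<longlonglongrightarrow> K \<psi> x\<^sub>0"
    using eval[OF Ke, of x\<^sub>0] by simp
  then have "(\<lambda>n. \<rho> n *\<^sub>R e (Suc n)) \<longlonglongrightarrow> K \<psi> x\<^sub>0 *\<^sub>R \<psi>"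
    by (intro tendsto_scaleR LIMSEQ_Suc[OF \<psi>])
  then have "K \<psi> = K \<psi> x\<^sub>0 *\<^sub>R \<psi>"
    using Ke LIMSEQ_unique unfolding Ke_eq by blast
  then show thesis
    using that[OF \<psi>_pos pos[OF \<psi>_pos]] by blast
qed

end

section \<open>Ground states\<close>

text \<open>
  For fixed \<open>t\<close> the quotient \<open>ln (c s) / s\<close> has the same value at \<open>s = t\<close> and at all \<open>s = t / n\<close>, and
  these tend to \<open>0\<close>, where the quotient tends to \<open>l\<close>.
\<close>
lemma exponential_of_multiplicative:
  fixes c :: "real \<Rightarrow> real"
  assumes pos: "\<And>t. t \<ge> 0 \<Longrightarrow> c t > 0" and c_0: "c 0 = 1"
    and mult: "\<And>s t. s \<ge> 0 \<Longrightarrow> t \<ge> 0 \<Longrightarrow> c (s + t) = c s * c t"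
    and lim: "((\<lambda>t. (c t - 1) / t) \<longlongrightarrow> l) (at_right 0)" and "t \<ge> 0"
  shows "c t = exp (l * t)"
proof (cases "t = 0")
  case False
  then have t: "t > 0" using \<open>t \<ge> 0\<close> by simp
  have "(c has_field_derivative l) (at 0 within {0<..})"
    using lim by (simp add: has_field_derivative_iff c_0)
  then have "((\<lambda>t. ln (c t)) has_field_derivative 1 / c 0 * l) (at 0 within {0<..})"
    using c_0 by (intro DERIV_chain'[OF _ DERIV_ln_divide]) auto
  then have ln_lim: "((\<lambda>t. ln (c t) / t) \<longlongrightarrow> l) (at_right 0)"
    by (simp add: has_field_derivative_iff c_0)
  have c_of_nat: "c (of_nat n * s) = c s ^ n" if "s \<ge> 0" for n s
  proof (induction n)
    case (Suc n)
    then show ?case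
      using that mult[of s "of_nat n * s"] by (simp add: algebra_simps)
  qed (simp add: c_0)
  have "filterlim (\<lambda>n. t * (1 / real (Suc n))) (at_right 0) sequentially"
    unfolding filterlim_at
    using t tendsto_mult_right_zero[OF LIMSEQ_inverse_real_of_nat, of t] by (simp add: inverse_eq_divide)
  from filterlim_compose[OF ln_lim this]
  have "(\<lambda>n. ln (c (t * (1 / real (Suc n)))) / (t * (1 / real (Suc n)))) \<longlonglongrightarrow> l" .
  moreover have "ln (c (t * (1 / real (Suc n)))) / (t * (1 / real (Suc n))) = ln (c t) / t" for n
  proof -
    define s where "s = t * (1 / real (Suc n))"
    have s: "s > 0" "t = of_nat (Suc n) * s"
      using t by (simp_all add: s_def)
    have "ln (c t) = of_nat (Suc n) * ln (c s)"
      unfolding s(2) using s(1) pos[of s] by (subst c_of_nat) (simp_all add: ln_realpow del: power_Suc of_nat_Suc)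
    then show ?thesis
      unfolding s_def[symmetric] using s by (simp add: s(2) del: of_nat_Suc)
  qed
  ultimately have "ln (c t) / t = l"
    by (simp only: LIMSEQ_const_iff)
  then have "ln (c t) = l * t"
    using t by (simp add: field_simps)
  then show ?thesis
    using pos[of t] t by (metis exp_ln less_imp_le)
qed (simp add: c_0)

context markov
begin

lemma harnack_operator_schrodinger:
  assumes cpt: "compact (UNIV :: 'a set)" and "T \<ge> 0" "\<epsilon> > 0"
    and A: "\<And>x y f. P T (bc_abs f) x \<ge> \<epsilon> * P T (bc_abs f) y"
  shows "harnack_operator (schrodinger P V T) (\<epsilon> * exp (- 2 * norm V * T))"
proof (rule harnack_operator.intro)
  show "compact (UNIV :: 'a set)" by (rule cpt)
  show "linear (schrodinger P V T)"
    using \<open>T \<ge> 0\<close> by (rule schrodinger_linear)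
  show "schrodinger P V T f x \<ge> 0" if "\<And>x. apply_bcontfun f x \<ge> 0" for f x
    using \<open>T \<ge> 0\<close> that by (rule schrodinger_nonneg)
  show "schrodinger P V T (const_bcontfun 1) x > 0" for x
    using schrodinger_bounds(1)[OF \<open>T \<ge> 0\<close>, of "const_bcontfun 1" V x] \<open>T \<ge> 0\<close>
    by (simp add: P_1 less_le_trans[OF exp_gt_zero])
  show "\<epsilon> * exp (- 2 * norm V * T) > 0"
    using \<open>\<epsilon> > 0\<close> by simp
  fix f :: "'a \<Rightarrow>\<^sub>C real" and x y
  assume f: "\<And>x. f x \<ge> 0"
  then have "bc_abs f = f"
    by (intro bcontfun_eqI) simp
  with A[of f y x] have "\<epsilon> * P T f y \<le> P T f x" by simp
  note B = schrodinger_bounds[OF \<open>T \<ge> 0\<close> f, of V]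
  have "\<epsilon> * exp (- 2 * norm V * T) * schrodinger P V T f y
      \<le> \<epsilon> * exp (- 2 * norm V * T) * (exp (norm V * T) * P T f y)"
    using \<open>\<epsilon> > 0\<close> by (intro mult_left_mono B) simp_all
  also have "\<dots> = exp (- norm V * T) * (\<epsilon> * P T f y)"
    by (simp add: exp_add[symmetric] algebra_simps)
  also have "\<dots> \<le> exp (- norm V * T) * P T f x"
    using \<open>\<epsilon> * P T f y \<le> P T f x\<close> by simp
  also have "\<dots> \<le> schrodinger P V T f x"
    by (rule B)
  finally show "\<epsilon> * exp (- 2 * norm V * T) * schrodinger P V T f y \<le> schrodinger P V T f x" .
qed

lemma schrodinger_pos:
  assumes "compact (UNIV :: 'a set)" "t \<ge> 0" "\<And>x. apply_bcontfun f x > 0"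
  shows "schrodinger P V t f x > 0"
proof -
  obtain m where m: "m > 0" "\<And>x. m \<le> f x"
    using positive_bounded_below[OF assms(1,3)] by blast
  have "P t (const_bcontfun m) x \<le> P t f x"
    using m assms(2) by (intro P_mono) auto
  then have "0 < P t f x"
    using m assms(2) by (simp add: P_const)
  then have "0 < exp (- norm V * t) * P t f x"
    by simp
  also have "\<dots> \<le> schrodinger P V t f x"
    using assms by (intro schrodinger_bounds) (auto intro: less_imp_le)
  finally show ?thesis .
qed

text \<open>An eigenvector is a multiple of its own image, and smoothness puts the image into the core.\<close>
lemma smooth_potential_eigenvector_in_core:
  assumes "smooth_potential P D V" "subspace D" "t > 0"
    and "schrodinger P V t f = \<kappa> *\<^sub>R f" "\<kappa> \<noteq> 0"
  shows "f \<in> D"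
proof -
  obtain p where p: "schrodinger_kernel P V p"
    and smooth: "\<And>t f :: 'a \<Rightarrow> real. t > 0 \<Longrightarrow> f \<in> borel_measurable borel \<Longrightarrow> bounded (range f) \<Longrightarrow>
      \<exists>g\<in>D. \<forall>x. g x = (\<integral>y. f y \<partial>p t x)"
    using assms(1) unfolding smooth_potential_def by blast
  have "apply_bcontfun f \<in> borel_measurable borel"
    by (intro borel_measurable_continuous_onI) simp
  then obtain g where g: "g \<in> D" "\<And>x. g x = (\<integral>y. f y \<partial>p t x)"
    using smooth[OF \<open>t > 0\<close>, of f] by auto
  have "g = \<kappa> *\<^sub>R f"
  proof (rule bcontfun_eqI)
    fix x
    have "schrodinger P V t f x = (\<integral>y. f y \<partial>p t x)"
      using p \<open>t > 0\<close> unfolding schrodinger_kernel_def by simp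
    then show "g x = (\<kappa> *\<^sub>R f) x"
      using g assms(4) by simp
  qed
  then have "(1 / \<kappa>) *\<^sub>R g = f"
    using assms(5) by simp
  then show ?thesis
    using g(1) assms(2) subspace_scale by metis
qed

text \<open>
  The operator at the time \<open>T\<close> of condition (A) has an eigenvector \<open>\<psi>\<close>.  It commutes with the
  operators at all other times, so these map \<open>\<psi>\<close> to eigenvectors for the same eigenvalue, that is, to
  multiples \<open>c t *\<^sub>R \<psi>\<close>.  The semigroup law makes \<open>c\<close> multiplicative, and membership of \<open>\<psi>\<close> in the
  domain of \<open>L\<close> makes it differentiable at \<open>0\<close>.
\<close>
lemma ground_state_exists:
  assumes cpt: "compact (UNIV :: 'a set)" and "cond_A P" and "smooth_potential P D V"
    and "subspace D" "D \<subseteq> gen_domain P"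
  obtains \<psi> l where "\<psi> \<in> D" "\<And>x. apply_bcontfun \<psi> x > 0"
    "generator P \<psi> + bc_mult V \<psi> = l *\<^sub>R \<psi>"
    "\<And>t. t \<ge> 0 \<Longrightarrow> schrodinger P V t \<psi> = exp (l * t) *\<^sub>R \<psi>"
proof -
  obtain T \<epsilon> where "T > 0" "\<epsilon> > 0" and A: "\<And>x y f. P T (bc_abs f) x \<ge> \<epsilon> * P T (bc_abs f) y"
    using \<open>cond_A P\<close> unfolding cond_A_def by blast
  let ?S = "schrodinger P V"
  interpret K: harnack_operator "?S T" "\<epsilon> * exp (- 2 * norm V * T)"
    using cpt \<open>T > 0\<close> \<open>\<epsilon> > 0\<close> A by (intro harnack_operator_schrodinger) auto
  obtain \<psi> \<kappa> where \<psi>: "\<And>x. apply_bcontfun \<psi> x > 0" and "\<kappa> > 0" and eig: "?S T \<psi> = \<kappa> *\<^sub>R \<psi>"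
    using K.eigenvector_exists by blast
  have "\<psi> \<in> D"
    using smooth_potential_eigenvector_in_core[OF assms(3,4) \<open>T > 0\<close> eig] \<open>\<kappa> > 0\<close> by simp
  then have dom: "\<psi> \<in> gen_domain P"
    using assms(5) by blast
  define c where "c = (\<lambda>t. ?S t \<psi> undefined / \<psi> undefined)"
  have S_c: "?S t \<psi> = c t *\<^sub>R \<psi>" if "t \<ge> 0" for t
  proof -
    have "?S T (?S t \<psi>) = ?S t (?S T \<psi>)"
      using schrodinger_add[of t T] schrodinger_add[of T t] that \<open>T > 0\<close> by (simp add: add.commute)
    also have "\<dots> = \<kappa> *\<^sub>R ?S t \<psi>"
      using linear_scale[OF schrodinger_linear[OF that]] eig by simp
    finally obtain k where "?S t \<psi> = k *\<^sub>R \<psi>"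
      using K.eigenvector_unique[OF \<psi> eig] by blast
    then show ?thesis
      using \<psi>[of undefined] by (simp add: c_def)
  qed
  have c_pos: "c t > 0" if "t \<ge> 0" for t
    unfolding c_def using schrodinger_pos[OF cpt that \<psi>] \<psi> by simp
  have c_0: "c 0 = 1"
    using \<psi>[of undefined] by (simp add: c_def)
  have c_mult: "c (s + t) = c s * c t" if "s \<ge> 0" "t \<ge> 0" for s t
  proof -
    have "c (s + t) *\<^sub>R \<psi> = ?S t (c s *\<^sub>R \<psi>)"
      using that schrodinger_add[of s t V \<psi>] S_c[of "s + t"] S_c[of s] by simp
    also have "\<dots> = (c s * c t) *\<^sub>R \<psi>"
      using linear_scale[OF schrodinger_linear[OF that(2)]] S_c[OF that(2)] by simp
    finally have "c (s + t) *\<^sub>R \<psi> = (c s * c t) *\<^sub>R \<psi>" .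
    then show ?thesis
      using \<psi>[of undefined] by auto
  qed
  define G where "G = generator P \<psi> + bc_mult V \<psi>"
  define l where "l = G undefined / \<psi> undefined"
  have "((\<lambda>t. (1 / t) *\<^sub>R (?S t \<psi> - \<psi>)) \<longlongrightarrow> G) (at_right 0)"
    unfolding G_def by (rule schrodinger_generator_tendsto[OF dom])
  moreover have "\<forall>\<^sub>F t in at_right 0. (1 / t) *\<^sub>R (?S t \<psi> - \<psi>) = ((c t - 1) / t) *\<^sub>R \<psi>"
    unfolding eventually_at_filter
    by (rule always_eventually) (auto simp: S_c algebra_simps diff_divide_distrib)
  ultimately have G: "((\<lambda>t. ((c t - 1) / t) *\<^sub>R \<psi>) \<longlongrightarrow> G) (at_right 0)"
    by (rule Lim_transform_eventually)
  from bounded_linear.tendsto[OF bounded_linear_eval[of undefined] this]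
  have "((\<lambda>t. (c t - 1) / t * \<psi> undefined) \<longlongrightarrow> G undefined) (at_right 0)"
    by simp
  from tendsto_divide[OF this tendsto_const[of "\<psi> undefined"]]
  have l: "((\<lambda>t. (c t - 1) / t) \<longlongrightarrow> l) (at_right 0)"
    using \<psi>[of undefined] by (simp add: l_def)
  have "G = l *\<^sub>R \<psi>"
    using tendsto_unique[OF trivial_limit_at_right_real G tendsto_scaleR[OF l tendsto_const]] .
  moreover have "?S t \<psi> = exp (l * t) *\<^sub>R \<psi>" if "t \<ge> 0" for t
    using S_c[OF that] exponential_of_multiplicative[OF c_pos c_0 c_mult l that] by simp
  ultimately show thesis
    using that \<open>\<psi> \<in> D\<close> \<psi> unfolding G_def by blast
qed

text \<open>
  A positive \<open>\<psi>\<close> dominates every \<open>f\<close> up to the factor \<open>norm f / min \<psi>\<close>.  By positivity the operator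
  norm therefore exceeds the growth \<open>exp (l * t)\<close> of \<open>\<psi>\<close> at most by a factor independent of \<open>t\<close>,
  which does not affect the exponential rate.
\<close>
lemma principal_eigenvalue_eqI:
  assumes cpt: "compact (UNIV :: 'a set)" and \<psi>: "\<And>x. apply_bcontfun \<psi> x > 0"
    and eig: "\<And>t. t \<ge> 0 \<Longrightarrow> schrodinger P V t \<psi> = exp (l * t) *\<^sub>R \<psi>"
  shows "principal_eigenvalue P V = l"
proof -
  let ?S = "schrodinger P V"
  obtain m where m: "m > 0" "\<And>x. m \<le> \<psi> x"
    using positive_bounded_below[OF cpt \<psi>] by blast
  have "m \<le> norm \<psi>"
    using m(2)[of undefined] apply_le_norm[of \<psi> undefined] by linarith
  define C where "C = norm \<psi> / m"
  have C: "C \<ge> 1"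
    using m(1) \<open>m \<le> norm \<psi>\<close> by (simp add: C_def)
  have bound: "norm (?S t f) \<le> C * exp (l * t) * norm f" if t: "t \<ge> 0" for t f
  proof (rule norm_bound)
    fix x
    let ?g = "(norm f / m) *\<^sub>R \<psi>"
    have g: "norm f \<le> ?g x" for x
      using m mult_left_mono[OF m(2)[of x], of "norm f"] by (simp add: field_simps)
    have "?S t (?g - f) x \<ge> 0" "?S t (?g + f) x \<ge> 0"
      by (intro schrodinger_nonneg t;
        use g apply_le_norm[of f] neg_norm_le_apply[of f] in \<open>smt (verit) minus_bcontfun.rep_eq plus_bcontfun.rep_eq\<close>)+
    then have "\<bar>?S t f x\<bar> \<le> ?S t ?g x"
      by (simp add: linear_add[OF schrodinger_linear[OF t]] linear_diff[OF schrodinger_linear[OF t]])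
    also have "\<dots> = norm f / m * exp (l * t) * \<psi> x"
      using linear_scale[OF schrodinger_linear[OF t]] eig[OF t] by simp
    also have "\<dots> \<le> norm f / m * exp (l * t) * norm \<psi>"
      using m by (intro mult_left_mono apply_le_norm) auto
    finally show "norm (?S t f x) \<le> C * exp (l * t) * norm f"
      by (simp add: C_def mult_ac)
  qed
  have bl: "bounded_linear (?S t)" if "t \<ge> 0" for t
    using schrodinger_linear[OF that] bound[OF that]
    by (intro bounded_linear_intro[where K = "C * exp (l * t)"])
      (simp_all add: linear_add linear_scale mult.commute)
  have upper: "onorm (?S t) \<le> C * exp (l * t)" if "t \<ge> 0" for t
    using C bound[OF that] by (intro onorm_bound) auto
  have lower: "exp (l * t) \<le> onorm (?S t)" if "t \<ge> 0" for t
    using onorm[OF bl[OF that], of \<psi>] eig[OF that] m(1) \<open>m \<le> norm \<psi>\<close>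
    by (auto simp: mult_le_cancel_right)
  have "((\<lambda>t. (1 / t) * ln (onorm (?S t))) \<longlongrightarrow> l) at_top"
  proof (rule tendsto_sandwich)
    show "\<forall>\<^sub>F t in at_top. l \<le> (1 / t) * ln (onorm (?S t))"
      using eventually_gt_at_top[of 0]
    proof eventually_elim
      case (elim t)
      have "ln (exp (l * t)) \<le> ln (onorm (?S t))"
        using lower[of t] elim by (intro ln_mono) (auto intro: less_le_trans[OF exp_gt_zero])
      then show ?case
        using elim by (simp add: field_simps)
    qed
    show "\<forall>\<^sub>F t in at_top. (1 / t) * ln (onorm (?S t)) \<le> l + ln C / t"
      using eventually_gt_at_top[of 0]
    proof eventually_elim
      case (elim t)
      have "ln (onorm (?S t)) \<le> ln (C * exp (l * t))"
        using upper[of t] lower[of t] elim C by (intro ln_mono) (auto intro: less_le_trans[OF exp_gt_zero])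
      also have "\<dots> = ln C + l * t"
        using C by (simp add: ln_mult)
      finally show ?case
        using elim by (simp add: field_simps)
    qed
    have "((\<lambda>t. l + ln C / t) \<longlongrightarrow> l + 0) at_top"
      by (intro tendsto_intros tendsto_divide_0[OF tendsto_const] filterlim_at_top_imp_at_infinity filterlim_ident)
    then show "((\<lambda>t. l + ln C / t) \<longlongrightarrow> l) at_top"
      by simp
  qed simp
  then show ?thesis
    unfolding principal_eigenvalue_def by (intro tendsto_Lim) auto
qed

end

section \<open>The generator and the carre du champ\<close>

lemma has_vector_derivative_imp_quotient:
  assumes "(f has_vector_derivative D) (at 0 within {0..1::real})"
  shows "((\<lambda>t. (1 / t) *\<^sub>R (f t - f 0)) \<longlongrightarrow> D) (at_right 0)"
proof -
  have "at 0 within {0..1::real} = at_right 0"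
    by (rule at_within_Icc_at_right) simp
  then have "((\<lambda>t. (1 / norm (t - 0)) *\<^sub>R (f t - (f 0 + (t - 0) *\<^sub>R D))) \<longlongrightarrow> 0) (at_right 0)"
    using assms by (simp add: has_vector_derivative_def has_derivative_within)
  moreover have "\<forall>\<^sub>F t in at_right 0. (1 / norm (t - 0)) *\<^sub>R (f t - (f 0 + (t - 0) *\<^sub>R D)) =
      (1 / t) *\<^sub>R (f t - f 0) - D"
    unfolding eventually_at_filter
    by (rule always_eventually) (auto simp: algebra_simps)
  ultimately have "((\<lambda>t. (1 / t) *\<^sub>R (f t - f 0) - D) \<longlongrightarrow> 0) (at_right 0)"
    by (rule Lim_transform_eventually)
  then show ?thesis
    by (rule LIM_zero_cancel)
qed

lemma integral_translate:
  fixes f :: "real \<Rightarrow> 'b::banach"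
  assumes "continuous_on {a + c..b + c} f"
  shows "integral {a..b} (\<lambda>s. f (s + c)) = integral {a + c..b + c} f"
proof -
  have "(f has_integral integral {a + c..b + c} f) (cbox (a + c) (b + c))"
    using assms by (simp add: integrable_integral integrable_continuous_interval)
  from has_integral_affinity'[OF this, of 1 c] show ?thesis
    by (simp add: integral_unique)
qed

context markov
begin

lemma generator_eqI:
  assumes "((\<lambda>t. (1 / t) *\<^sub>R (P t f - f)) \<longlongrightarrow> g) (at_right 0)"
  shows "f \<in> gen_domain P" "generator P f = g"
  using assms tendsto_Lim[OF trivial_limit_at_right_real] unfolding gen_domain_def generator_def by blast+

lemma generator_add:
  assumes "f \<in> gen_domain P" "g \<in> gen_domain P"
  shows "f + g \<in> gen_domain P" "generator P (f + g) = generator P f + generator P g"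
proof -
  have "((\<lambda>t. (1 / t) *\<^sub>R (P t f - f) + (1 / t) *\<^sub>R (P t g - g)) \<longlongrightarrow> generator P f + generator P g) (at_right 0)"
    by (intro tendsto_add generator_tendsto assms)
  moreover have "\<forall>\<^sub>F t in at_right 0. (1 / t) *\<^sub>R (P t f - f) + (1 / t) *\<^sub>R (P t g - g) =
      (1 / t) *\<^sub>R (P t (f + g) - (f + g))"
    unfolding eventually_at_filter
    by (rule always_eventually) (auto simp: P_linear algebra_simps)
  ultimately have "((\<lambda>t. (1 / t) *\<^sub>R (P t (f + g) - (f + g))) \<longlongrightarrow> generator P f + generator P g) (at_right 0)"
    by (rule Lim_transform_eventually)
  then show "f + g \<in> gen_domain P" "generator P (f + g) = generator P f + generator P g"
    by (rule generator_eqI)+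
qed

lemma generator_scaleR:
  assumes "f \<in> gen_domain P"
  shows "c *\<^sub>R f \<in> gen_domain P" "generator P (c *\<^sub>R f) = c *\<^sub>R generator P f"
proof -
  have "((\<lambda>t. c *\<^sub>R ((1 / t) *\<^sub>R (P t f - f))) \<longlongrightarrow> c *\<^sub>R generator P f) (at_right 0)"
    by (intro tendsto_scaleR tendsto_const generator_tendsto assms)
  moreover have "\<forall>\<^sub>F t in at_right 0. c *\<^sub>R ((1 / t) *\<^sub>R (P t f - f)) = (1 / t) *\<^sub>R (P t (c *\<^sub>R f) - c *\<^sub>R f)"
    unfolding eventually_at_filter
    by (rule always_eventually) (auto simp: P_linear algebra_simps)
  ultimately have "((\<lambda>t. (1 / t) *\<^sub>R (P t (c *\<^sub>R f) - c *\<^sub>R f)) \<longlongrightarrow> c *\<^sub>R generator P f) (at_right 0)"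
    by (rule Lim_transform_eventually)
  then show "c *\<^sub>R f \<in> gen_domain P" "generator P (c *\<^sub>R f) = c *\<^sub>R generator P f"
    by (rule generator_eqI)+
qed

lemma generator_const:
  shows "const_bcontfun c \<in> gen_domain P" "generator P (const_bcontfun c) = 0"
proof -
  have "((\<lambda>t. 0 :: 'a \<Rightarrow>\<^sub>C real) \<longlongrightarrow> 0) (at_right (0::real))"
    by simp
  moreover have "\<forall>\<^sub>F t in at_right 0. 0 = (1 / t) *\<^sub>R (P t (const_bcontfun c) - const_bcontfun c)"
    unfolding eventually_at_filter by (rule always_eventually) (auto simp: P_const)
  ultimately have "((\<lambda>t. (1 / t) *\<^sub>R (P t (const_bcontfun c) - const_bcontfun c)) \<longlongrightarrow> 0) (at_right 0)"
    by (rule Lim_transform_eventually)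
  then show "const_bcontfun c \<in> gen_domain P" "generator P (const_bcontfun c) = 0"
    by (rule generator_eqI)+
qed

text \<open>The positive maximum principle, stated at a minimum with value \<open>0\<close>.\<close>
lemma generator_nonneg_at_zero:
  assumes "f \<in> gen_domain P" "\<And>y. apply_bcontfun f y \<ge> 0" "f x = 0"
  shows "generator P f x \<ge> 0"
proof (rule tendsto_lowerbound)
  show "((\<lambda>t. ((1 / t) *\<^sub>R (P t f - f)) x) \<longlongrightarrow> generator P f x) (at_right 0)"
    by (rule bounded_linear.tendsto[OF bounded_linear_eval generator_tendsto[OF assms(1)]])
  show "\<forall>\<^sub>F t in at_right 0. 0 \<le> ((1 / t) *\<^sub>R (P t f - f)) x"
    unfolding eventually_at_filter
    by (rule always_eventually) (use assms(3) in \<open>auto intro!: divide_nonneg_pos P_nonneg assms(2)\<close>)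
qed simp

text \<open>
  Truncated resolvents supply functions in the domain whose image under \<open>b - L\<close> is known:
  it is \<open>f\<close> up to the exponentially damped \<open>P T f\<close>.  Applying \<open>P h\<close> shifts the interval of
  integration by \<open>h\<close>, so only the contributions of its two ends have to be differentiated in \<open>h\<close>.
\<close>
lemma generator_laplace:
  fixes b T :: real and f :: "'a \<Rightarrow>\<^sub>C real"
  assumes "T \<ge> 0"
  defines "g \<equiv> integral {0..T} (\<lambda>s. exp (- b * s) *\<^sub>R P s f)"
  shows "g \<in> gen_domain P" "generator P g = b *\<^sub>R g + exp (- b * T) *\<^sub>R P T f - f"
proof -
  define F where "F = (\<lambda>s. exp (- b * s) *\<^sub>R P s f)"
  have F: "continuous_on A F" if "A \<subseteq> {0..}" for A
    unfolding F_def by (intro continuous_intros) (use that in auto)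
  \<comment> \<open>\<open>H h\<close> is \<open>P h g\<close>, written as the integral of \<open>F\<close> over \<open>[h, T + h]\<close> relative to the one over \<open>[0, T]\<close>.\<close>
  define H where "H = (\<lambda>h. exp (b * h) *\<^sub>R (g + integral {0..h} (\<lambda>s. F (s + T)) - integral {0..h} F))"
  have g_F: "g = integral {0..T} F"
    by (simp add: g_def F_def)
  have P_g: "P h g = H h" if "h \<ge> 0" for h
  proof -
    have "(F has_integral g) {0..T}"
      unfolding g_F by (intro integrable_integral integrable_continuous_interval F) auto
    then have "((\<lambda>s. P h (F s)) has_integral P h g) {0..T}"
      using that by (rule has_integral_P)
    then have "P h g = integral {0..T} (\<lambda>s. P h (F s))"
      by (simp add: integral_unique)
    also have "\<dots> = integral {0..T} (\<lambda>s. exp (b * h) *\<^sub>R F (s + h))"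
    proof (rule integral_cong)
      fix s assume "s \<in> {0..T}"
      then have "P (s + h) f = P h (P s f)"
        using that P_add[of h s f] by (simp add: add.commute)
      then show "P h (F s) = exp (b * h) *\<^sub>R F (s + h)"
        using that by (simp add: F_def P_linear exp_add[symmetric] algebra_simps)
    qed
    also have "\<dots> = exp (b * h) *\<^sub>R integral {h..T + h} F"
      using integral_translate[of 0 h T F] F[of "{h..T + h}"] that by simp
    also have "integral {h..T + h} F = g + integral {T..T + h} F - integral {0..h} F"
    proof -
      have int: "F integrable_on {0..T + h}"
        by (intro integrable_continuous_interval F) auto
      have "integral {0..T} F + integral {T..T + h} F = integral {0..T + h} F"
        "integral {0..h} F + integral {h..T + h} F = integral {0..T + h} F"
        using that \<open>T \<ge> 0\<close> by (intro Henstock_Kurzweil_Integration.integral_combine int; simp)+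
      then show ?thesis
        by (simp add: g_F algebra_simps)
    qed
    also have "integral {T..T + h} F = integral {0..h} (\<lambda>s. F (s + T))"
      using integral_translate[of 0 T h F] F[of "{T..T + h}"] \<open>T \<ge> 0\<close> by (simp add: add.commute)
    finally show ?thesis
      by (simp add: H_def)
  qed
  have "(H has_vector_derivative exp (b * 0) *\<^sub>R (0 + F (0 + T) - F 0) +
      (b * exp (b * 0)) *\<^sub>R (g + integral {0..0} (\<lambda>s. F (s + T)) - integral {0..0} F)) (at 0 within {0..1})"
    unfolding H_def
  proof (intro has_vector_derivative_scaleR has_vector_derivative_diff has_vector_derivative_add
      has_vector_derivative_const integral_has_vector_derivative)
    show "((\<lambda>h. exp (b * h)) has_field_derivative b * exp (b * 0)) (at 0 within {0..1})"
      by (auto intro!: derivative_eq_intros)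
    show "continuous_on {0..1} (\<lambda>s. F (s + T))"
      by (intro continuous_on_compose2[OF F[OF order_refl]] continuous_intros) (use \<open>T \<ge> 0\<close> in auto)
  qed (auto intro: F)
  then have "(H has_vector_derivative b *\<^sub>R g + exp (- b * T) *\<^sub>R P T f - f) (at 0 within {0..1})"
    by (simp add: F_def add.commute[of _ "b *\<^sub>R g"] add_diff_eq)
  from has_vector_derivative_imp_quotient[OF this]
  have "((\<lambda>t. (1 / t) *\<^sub>R (H t - H 0)) \<longlongrightarrow> b *\<^sub>R g + exp (- b * T) *\<^sub>R P T f - f) (at_right 0)" .
  moreover have "\<forall>\<^sub>F t in at_right 0. (1 / t) *\<^sub>R (H t - H 0) = (1 / t) *\<^sub>R (P t g - g)"
    unfolding eventually_at_filter
    by (rule always_eventually) (auto simp: P_g[symmetric])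
  ultimately have "((\<lambda>t. (1 / t) *\<^sub>R (P t g - g)) \<longlongrightarrow> b *\<^sub>R g + exp (- b * T) *\<^sub>R P T f - f) (at_right 0)"
    by (rule Lim_transform_eventually)
  then show "g \<in> gen_domain P" "generator P g = b *\<^sub>R g + exp (- b * T) *\<^sub>R P T f - f"
    by (rule generator_eqI)+
qed

text \<open>
  At \<open>x\<close>, the right-hand side is \<open>L\<close> applied to \<open>w (h - h x)\<^sup>2\<close>, and the left-hand side is \<open>m\<close> times
  \<open>L\<close> applied to \<open>(h - h x)\<^sup>2\<close>, because \<open>L\<close> vanishes on constants.  The difference
  \<open>(w - m) (h - h x)\<^sup>2\<close> is nonnegative and vanishes at \<open>x\<close>.
\<close>
lemma weighted_carre_du_champ_ge:
  assumes dom: "h \<in> gen_domain P" "bc_mult h h \<in> gen_domain P" "w \<in> gen_domain P"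
      "bc_mult w h \<in> gen_domain P" "bc_mult w (bc_mult h h) \<in> gen_domain P"
    and m: "\<And>y. m \<le> apply_bcontfun w y"
  shows "m * carre_du_champ P h x \<le>
    generator P (bc_mult w (bc_mult h h)) x - 2 * h x * generator P (bc_mult w h) x + (h x)\<^sup>2 * generator P w x"
proof -
  let ?L = "generator P"
  define wsq where "wsq = bc_mult w (bc_mult h h) + ((- 2 * h x) *\<^sub>R bc_mult w h + (h x)\<^sup>2 *\<^sub>R w)"
  define sq where "sq = bc_mult h h + ((- 2 * h x) *\<^sub>R h + const_bcontfun ((h x)\<^sup>2))"
  have wsq: "wsq \<in> gen_domain P"
    "?L wsq = ?L (bc_mult w (bc_mult h h)) + ((- 2 * h x) *\<^sub>R ?L (bc_mult w h) + (h x)\<^sup>2 *\<^sub>R ?L w)"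
    unfolding wsq_def by (simp_all add: generator_add generator_scaleR dom del: scaleR_minus_left)
  have sq: "sq \<in> gen_domain P" "?L sq = ?L (bc_mult h h) + (- 2 * h x) *\<^sub>R ?L h"
    unfolding sq_def by (simp_all add: generator_add generator_scaleR generator_const dom del: scaleR_minus_left)
  have val: "(wsq + (- m) *\<^sub>R sq) y = (w y - m) * (h y - h x)\<^sup>2" for y
    by (simp add: wsq_def sq_def power2_eq_square algebra_simps)
  have "?L (wsq + (- m) *\<^sub>R sq) x \<ge> 0"
  proof (rule generator_nonneg_at_zero)
    show "wsq + (- m) *\<^sub>R sq \<in> gen_domain P"
      by (intro generator_add generator_scaleR wsq sq)
    show "(wsq + (- m) *\<^sub>R sq) y \<ge> 0" for y
      unfolding val using m[of y] by simp
    show "(wsq + (- m) *\<^sub>R sq) x = 0"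
      unfolding val by simp
  qed
  moreover have "?L (wsq + (- m) *\<^sub>R sq) = ?L wsq + (- m) *\<^sub>R ?L sq"
    using wsq(1) sq(1) by (simp add: generator_add generator_scaleR del: scaleR_minus_left)
  ultimately have "0 \<le> (?L wsq + (- m) *\<^sub>R ?L sq) x"
    by (simp only:)
  then show ?thesis
    by (simp add: wsq(2) sq(2) carre_du_champ_def algebra_simps)
qed

text \<open>The weight \<open>1\<close> turns the right-hand side above into the carre du champ itself.\<close>
lemma carre_du_champ_nonneg:
  assumes "h \<in> gen_domain P" "bc_mult h h \<in> gen_domain P"
  shows "carre_du_champ P h x \<ge> 0"
proof -
  have one: "bc_mult (const_bcontfun 1) f = f" for f :: "'a \<Rightarrow>\<^sub>C real"
    by (rule bcontfun_eqI) simp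
  show ?thesis
    using weighted_carre_du_champ_ge[of h "const_bcontfun 1" 0 x] assms
    by (simp add: one generator_const carre_du_champ_def)
qed

end

section \<open>Stationarity and support of equilibrium measures\<close>

lemma borel_prob_integrable_continuous:
  fixes f :: "'a::metric_space \<Rightarrow> real"
  assumes "compact (UNIV :: 'a set)" "borel_prob \<mu>" "continuous_on UNIV f"
  shows "integrable \<mu> f"
proof -
  interpret prob_space \<mu>
    using assms(2) by (simp add: borel_prob_def)
  obtain g :: "'a \<Rightarrow>\<^sub>C real" where g: "\<And>x. g x = f x"
    using bcontfun_of_continuous[OF assms(1,3)] by blast
  have "f \<in> borel_measurable \<mu>"
    using borel_measurable_continuous_onI[OF assms(3)] assms(2)
    by (simp add: borel_prob_def cong: measurable_cong_sets)
  moreover have "norm (f x) \<le> norm g" for x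
    using norm_bounded[of g x] g by simp
  ultimately show ?thesis
    by (intro integrable_const_bound[where B = "norm g"]) auto
qed

context markov
begin

text \<open>
  Compare \<open>\<psi>\<close> with \<open>\<psi> + e g\<close> for small \<open>e > 0\<close>: the difference of the two integrands is
  \<open>e Q / (\<psi> + e g)\<close> with \<open>Q = Lg - (L\<psi> / \<psi>) g\<close>.  Dividing by \<open>e\<close> and letting \<open>e\<close> tend to \<open>0\<close> gives one
  inequality for \<open>g\<close>, and replacing \<open>g\<close> by \<open>- g\<close> gives the other.
\<close>
lemma first_variation:
  assumes cpt: "compact (UNIV :: 'a set)" and \<mu>: "borel_prob \<mu>"
    and \<psi>: "\<psi> \<in> pos_domain P" and g: "g \<in> gen_domain P"
    and min: "\<And>u. u \<in> pos_domain P \<Longrightarrow>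
      (\<integral>x. generator P \<psi> x / \<psi> x \<partial>\<mu>) \<le> (\<integral>x. generator P u x / u x \<partial>\<mu>)"
  shows "(\<integral>x. (generator P g x - generator P \<psi> x / \<psi> x * g x) / \<psi> x \<partial>\<mu>) = 0"
proof -
  let ?L = "generator P"
  have dom: "\<psi> \<in> gen_domain P" and pos: "\<And>x. \<psi> x > 0"
    using \<psi> by (auto simp: pos_domain_def)
  have \<psi>_ne: "\<psi> x \<noteq> 0" for x using pos[of x] by simp
  obtain m where m: "m > 0" "\<And>x. m \<le> \<psi> x"
    using positive_bounded_below[OF cpt pos] by blast
  note integrable = borel_prob_integrable_continuous[OF cpt \<mu>]
  have nonneg: "(\<integral>x. (?L g x - ?L \<psi> x / \<psi> x * g x) / \<psi> x \<partial>\<mu>) \<ge> 0" if g: "g \<in> gen_domain P" for g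
  proof -
    obtain Q :: "'a \<Rightarrow>\<^sub>C real" where Q: "\<And>x. Q x = ?L g x - ?L \<psi> x / \<psi> x * g x"
      by (rule bcontfun_of_continuous[OF cpt, of "\<lambda>x. ?L g x - ?L \<psi> x / \<psi> x * g x"])
        (auto intro!: continuous_intros simp: \<psi>_ne)
    define N where "N = norm g + 1"
    have N: "N > 0" "norm g \<le> N"
      by (simp_all add: N_def add_nonneg_pos)
    \<comment> \<open>Steps this small keep \<open>\<psi> + e n *\<^sub>R g\<close> above \<open>m / 2\<close>, hence in the admissible class.\<close>
    define e where "e = (\<lambda>n. m / 2 / N * (1 / real (Suc n)))"
    have e_pos: "e n > 0" for n
      using m(1) N by (simp add: e_def)
    have e_lim: "e \<longlonglongrightarrow> 0"
      unfolding e_def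
      using tendsto_mult_right_zero[OF LIMSEQ_inverse_real_of_nat, of "m / 2 / N"]
      by (simp add: inverse_eq_divide)
    have lower: "m / 2 \<le> \<psi> x + e n * g x" for n x
    proof -
      have "e n * norm g \<le> m / 2 / N * 1 * N"
        unfolding e_def using m(1) N by (intro mult_mono) auto
      also have "\<dots> = m / 2"
        using N by simp
      finally have "e n * norm g \<le> m / 2" .
      moreover have "e n * (- norm g) \<le> e n * g x"
        using e_pos[of n] by (intro mult_left_mono neg_norm_le_apply) auto
      ultimately show ?thesis
        using m(2)[of x] by simp
    qed
    have ne: "\<psi> x + e n * g x \<noteq> 0" for n x
      using lower[of x n] m(1) by linarith
    have term_nonneg: "(\<integral>x. Q x / (\<psi> x + e n * g x) \<partial>\<mu>) \<ge> 0" for n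
    proof -
      have u: "\<psi> + e n *\<^sub>R g \<in> pos_domain P"
        unfolding pos_domain_def
        using generator_add(1)[OF dom generator_scaleR(1)[OF g, of "e n"]] lower[of _ n] m(1)
        by (auto intro: less_le_trans[of 0 "m / 2"])
      have "(\<integral>x. (?L \<psi> x + e n * ?L g x) / (\<psi> x + e n * g x) \<partial>\<mu>) - (\<integral>x. ?L \<psi> x / \<psi> x \<partial>\<mu>) \<ge> 0"
        using min[OF u] by (simp add: generator_add[OF dom generator_scaleR(1)[OF g]] generator_scaleR[OF g])
      also have "(\<integral>x. (?L \<psi> x + e n * ?L g x) / (\<psi> x + e n * g x) \<partial>\<mu>) - (\<integral>x. ?L \<psi> x / \<psi> x \<partial>\<mu>) =
          (\<integral>x. (?L \<psi> x + e n * ?L g x) / (\<psi> x + e n * g x) - ?L \<psi> x / \<psi> x \<partial>\<mu>)"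
        by (intro Bochner_Integration.integral_diff[symmetric] integrable continuous_intros)
          (auto simp: ne \<psi>_ne)
      also have "\<dots> = (\<integral>x. e n * (Q x / (\<psi> x + e n * g x)) \<partial>\<mu>)"
        by (rule Bochner_Integration.integral_cong) (use ne \<psi>_ne in \<open>auto simp: Q field_simps\<close>)
      also have "\<dots> = e n * (\<integral>x. Q x / (\<psi> x + e n * g x) \<partial>\<mu>)"
        by (rule integral_mult_right_zero)
      finally show ?thesis
        using e_pos[of n] by (simp add: zero_le_mult_iff)
    qed
    have "(\<lambda>n. \<integral>x. Q x / (\<psi> x + e n * g x) \<partial>\<mu>) \<longlonglongrightarrow> (\<integral>x. Q x / \<psi> x \<partial>\<mu>)"
    proof (rule integral_dominated_convergence[where w = "\<lambda>x. norm Q / (m / 2)"])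
      show "(\<lambda>x. Q x / \<psi> x) \<in> borel_measurable \<mu>"
        by (intro borel_measurable_integrable integrable continuous_intros) (auto simp: \<psi>_ne)
      show "(\<lambda>x. Q x / (\<psi> x + e n * g x)) \<in> borel_measurable \<mu>" for n
        by (intro borel_measurable_integrable integrable continuous_intros) (auto simp: ne)
      show "integrable \<mu> (\<lambda>x. norm Q / (m / 2))"
        by (intro integrable continuous_intros)
      show "AE x in \<mu>. (\<lambda>n. Q x / (\<psi> x + e n * g x)) \<longlonglongrightarrow> Q x / \<psi> x"
      proof (rule AE_I2)
        fix x
        have "(\<lambda>n. Q x / (\<psi> x + e n * g x)) \<longlonglongrightarrow> Q x / (\<psi> x + 0 * g x)"
          by (intro tendsto_intros e_lim) (simp add: \<psi>_ne)
        then show "(\<lambda>n. Q x / (\<psi> x + e n * g x)) \<longlonglongrightarrow> Q x / \<psi> x" by simp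
      qed
      show "AE x in \<mu>. norm (Q x / (\<psi> x + e n * g x)) \<le> norm Q / (m / 2)" for n
      proof (rule AE_I2)
        fix x
        have "norm (Q x) / norm (\<psi> x + e n * g x) \<le> norm Q / (m / 2)"
          using lower[of x n] m(1) by (intro frac_le norm_bounded) auto
        then show "norm (Q x / (\<psi> x + e n * g x)) \<le> norm Q / (m / 2)"
          by (simp only: norm_divide)
      qed
    qed
    then have "(\<integral>x. Q x / \<psi> x \<partial>\<mu>) \<ge> 0"
      by (rule LIMSEQ_le_const) (use term_nonneg in auto)
    then show ?thesis
      by (simp add: Q)
  qed
  have "(\<integral>x. (?L (- g) x - ?L \<psi> x / \<psi> x * (- g) x) / \<psi> x \<partial>\<mu>) \<ge> 0"
    using nonneg[of "- g"] generator_scaleR(1)[OF g, of "-1"] by simp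
  moreover have "?L (- g) = - ?L g"
    using generator_scaleR(2)[OF g, of "-1"] by simp
  moreover have "(- ?L g x + ?L \<psi> x / \<psi> x * g x) / \<psi> x = - ((?L g x - ?L \<psi> x / \<psi> x * g x) / \<psi> x)" for x
    by (simp add: minus_divide_left)
  ultimately have "- (\<integral>x. (?L g x - ?L \<psi> x / \<psi> x * g x) / \<psi> x \<partial>\<mu>) \<ge> 0"
    by simp
  then show ?thesis
    using nonneg[OF g] by simp
qed

text \<open>
  For the ground state the integrand \<open>L\<psi> / \<psi>\<close> is \<open>l - V\<close>, and the equation defining an equilibrium
  measure says precisely that the infimum in the Donsker-Varadhan rate is \<open>l - \<integral> V d\<mu>\<close>.
\<close>
lemma ground_state_minimises:
  assumes cpt: "compact (UNIV :: 'a set)" and eq: "equilibrium_measure P V \<mu>"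
    and \<psi>: "\<And>x. apply_bcontfun \<psi> x > 0" "generator P \<psi> + bc_mult V \<psi> = l *\<^sub>R \<psi>"
    and l: "principal_eigenvalue P V = l" and u: "u \<in> pos_domain P"
  shows "(\<integral>x. generator P \<psi> x / \<psi> x \<partial>\<mu>) \<le> (\<integral>x. generator P u x / u x \<partial>\<mu>)"
proof -
  have \<mu>: "borel_prob \<mu>"
    and rate: "ereal l = ereal (\<integral>x. V x \<partial>\<mu>) - dv_rate P \<mu>"
    using eq l by (auto simp: equilibrium_measure_def)
  interpret prob_space \<mu>
    using \<mu> by (simp add: borel_prob_def)
  have "generator P \<psi> x / \<psi> x = l - V x" for x
  proof -
    have "generator P \<psi> x + V x * \<psi> x = l * \<psi> x"
      using arg_cong[OF \<psi>(2), of "\<lambda>f. f x"] by simp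
    then show ?thesis
      using \<psi>(1)[of x] by (simp add: field_simps)
  qed
  then have "(\<integral>x. generator P \<psi> x / \<psi> x \<partial>\<mu>) = (\<integral>x. l - V x \<partial>\<mu>)"
    by simp
  also have "\<dots> = (\<integral>x. l \<partial>\<mu>) - (\<integral>x. V x \<partial>\<mu>)"
    by (intro Bochner_Integration.integral_diff borel_prob_integrable_continuous cpt \<mu> continuous_intros) auto
  also have "\<dots> = l - (\<integral>x. V x \<partial>\<mu>)"
    by (simp add: prob_space)
  finally have \<psi>_int: "(\<integral>x. generator P \<psi> x / \<psi> x \<partial>\<mu>) = l - (\<integral>x. V x \<partial>\<mu>)" .
  have "(INF u\<in>pos_domain P. ereal (\<integral>x. generator P u x / u x \<partial>\<mu>)) = ereal (l - (\<integral>x. V x \<partial>\<mu>))"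
    using rate unfolding dv_rate_def
    by (cases "INF u\<in>pos_domain P. ereal (\<integral>x. generator P u x / u x \<partial>\<mu>)") auto
  then have "ereal (l - (\<integral>x. V x \<partial>\<mu>)) \<le> ereal (\<integral>x. generator P u x / u x \<partial>\<mu>)"
    using INF_lower[OF u, of "\<lambda>u. ereal (\<integral>x. generator P u x / u x \<partial>\<mu>)"] by simp
  then show ?thesis
    by (simp add: \<psi>_int)
qed

text \<open>
  Testing with the truncated resolvent \<open>g\<close> of \<open>f\<close> up to the time \<open>T\<close> of condition (B) gives
  \<open>\<integral> f / \<psi> d\<mu> = \<integral> (exp (- b T) P T f + (b + V - l) g) / \<psi> d\<mu>\<close>.  The second term is nonnegative once
  \<open>b\<close> is large, and \<open>P T f\<close> is bounded below by a positive constant.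
\<close>
lemma stationary_measure_full_support:
  fixes V \<psi> f :: "'a \<Rightarrow>\<^sub>C real"
  assumes cpt: "compact (UNIV :: 'a set)" and B: "cond_B P" and \<mu>: "borel_prob \<mu>"
    and \<psi>: "\<And>x. apply_bcontfun \<psi> x > 0"
    and stat: "\<And>g. g \<in> gen_domain P \<Longrightarrow> (\<integral>x. (generator P g x + (V x - l) * g x) / \<psi> x \<partial>\<mu>) = 0"
    and f: "\<And>x. apply_bcontfun f x \<ge> 0" "f \<noteq> 0"
  shows "(\<integral>x. f x / \<psi> x \<partial>\<mu>) > 0"
proof -
  interpret prob_space \<mu>
    using \<mu> by (simp add: borel_prob_def)
  note integrable = borel_prob_integrable_continuous[OF cpt \<mu>]
  have \<psi>_ne: "\<psi> x \<noteq> 0" for x using \<psi>[of x] by simp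
  obtain T where T: "T > 0" and P_T: "\<And>x. P T f x > 0"
    using B f unfolding cond_B_def by blast
  obtain m where m: "m > 0" "\<And>x. m \<le> P T f x"
    using positive_bounded_below[OF cpt P_T] by blast
  define b where "b = \<bar>l\<bar> + norm V"
  define g where "g = integral {0..T} (\<lambda>s. exp (- b * s) *\<^sub>R P s f)"
  have g: "g \<in> gen_domain P" "generator P g = b *\<^sub>R g + exp (- b * T) *\<^sub>R P T f - f"
    unfolding g_def using T by (intro generator_laplace; simp)+
  have g_nonneg: "g x \<ge> 0" for x
  proof -
    have "((\<lambda>s. exp (- b * s) *\<^sub>R P s f) has_integral g) {0..T}"
      unfolding g_def by (intro integrable_integral integrable_continuous_interval continuous_intros) auto
    from has_integral_linear[OF this bounded_linear_eval[of x]]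
    have "((\<lambda>s. exp (- b * s) * P s f x) has_integral g x) {0..T}"
      by (simp add: o_def)
    then show ?thesis
      by (rule has_integral_nonneg) (auto intro!: mult_nonneg_nonneg P_nonneg f)
  qed
  define c where "c = exp (- b * T) * m / norm \<psi>"
  have norm_\<psi>: "norm \<psi> > 0"
    using \<psi>[of undefined] apply_le_norm[of \<psi> undefined] by linarith
  have "c \<le> f x / \<psi> x + (generator P g x + (V x - l) * g x) / \<psi> x" for x
  proof -
    have "c \<le> exp (- b * T) * P T f x / \<psi> x"
      unfolding c_def using m(2)[of x] m(1) \<psi>[of x] apply_le_norm[of \<psi> x]
      by (intro frac_le) auto
    moreover have "b + V x - l \<ge> 0"
      unfolding b_def using neg_norm_le_apply[of V x] by linarith
    then have "0 \<le> (b + V x - l) * g x / \<psi> x"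
      using g_nonneg[of x] \<psi>[of x] by simp
    moreover have "f x / \<psi> x + (generator P g x + (V x - l) * g x) / \<psi> x =
        exp (- b * T) * P T f x / \<psi> x + (b + V x - l) * g x / \<psi> x"
      by (simp add: g(2) add_divide_distrib[symmetric] algebra_simps)
    ultimately show ?thesis by linarith
  qed
  then have "(\<integral>x. c \<partial>\<mu>) \<le> (\<integral>x. f x / \<psi> x + (generator P g x + (V x - l) * g x) / \<psi> x \<partial>\<mu>)"
    by (intro integral_mono integrable continuous_intros) (auto simp: \<psi>_ne)
  also have "\<dots> = (\<integral>x. f x / \<psi> x \<partial>\<mu>) + (\<integral>x. (generator P g x + (V x - l) * g x) / \<psi> x \<partial>\<mu>)"
    by (intro Bochner_Integration.integral_add integrable continuous_intros) (auto simp: \<psi>_ne)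
  also have "\<dots> = (\<integral>x. f x / \<psi> x \<partial>\<mu>)"
    using stat[OF g(1)] by simp
  finally have "c \<le> (\<integral>x. f x / \<psi> x \<partial>\<mu>)"
    by (simp add: prob_space)
  moreover have "c > 0"
    using m(1) norm_\<psi> by (simp add: c_def)
  ultimately show ?thesis by linarith
qed

text \<open>
  The stationarity relation is the first variation, with \<open>L\<psi> / \<psi>\<close> replaced by \<open>l - V\<close>.
\<close>
lemma equilibrium_ground_state:
  assumes cpt: "compact (UNIV :: 'a set)" and "cond_A P" "smooth_potential P D V"
    and "subspace D" "D \<subseteq> gen_domain P" and eq: "equilibrium_measure P V \<mu>"
  obtains \<psi> l where "\<psi> \<in> D" "\<And>x. apply_bcontfun \<psi> x > 0"
    "\<And>x. generator P \<psi> x = (l - V x) * \<psi> x"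
    "\<And>g. g \<in> gen_domain P \<Longrightarrow> (\<integral>x. (generator P g x + (V x - l) * g x) / \<psi> x \<partial>\<mu>) = 0"
proof -
  obtain \<psi> l where "\<psi> \<in> D" and \<psi>: "\<And>x. apply_bcontfun \<psi> x > 0"
    and gen: "generator P \<psi> + bc_mult V \<psi> = l *\<^sub>R \<psi>"
    and eig: "\<And>t. t \<ge> 0 \<Longrightarrow> schrodinger P V t \<psi> = exp (l * t) *\<^sub>R \<psi>"
    using ground_state_exists[OF assms(1-5)] by blast
  have l: "principal_eigenvalue P V = l"
    using principal_eigenvalue_eqI[OF cpt \<psi> eig] .
  have gen_x: "generator P \<psi> x = (l - V x) * \<psi> x" for x
    using arg_cong[OF gen, of "\<lambda>f. f x"] by (simp add: algebra_simps)
  have pos_dom: "\<psi> \<in> pos_domain P"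
    using \<open>\<psi> \<in> D\<close> assms(5) \<psi> by (auto simp: pos_domain_def)
  have \<mu>: "borel_prob \<mu>"
    using eq by (simp add: equilibrium_measure_def)
  have "(\<integral>x. (generator P g x + (V x - l) * g x) / \<psi> x \<partial>\<mu>) = 0" if "g \<in> gen_domain P" for g
  proof -
    have "generator P g x + (V x - l) * g x = generator P g x - generator P \<psi> x / \<psi> x * g x" for x
    proof -
      have "generator P \<psi> x / \<psi> x = l - V x"
        using \<psi>[of x] by (simp add: gen_x)
      then show ?thesis
        by (simp add: left_diff_distrib)
    qed
    then show ?thesis
      using first_variation[OF cpt \<mu> pos_dom that ground_state_minimises[OF cpt eq \<psi> gen l]] by simp
  qed
  then show thesis
    using that[OF \<open>\<psi> \<in> D\<close> \<psi> gen_x] by blast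
qed

end

section \<open>Equilibrium measures determine the potential\<close>

theorem theorem3:
  fixes P :: "real \<Rightarrow> ('a::metric_space \<Rightarrow>\<^sub>C real) \<Rightarrow> ('a \<Rightarrow>\<^sub>C real)"
    and D :: "('a \<Rightarrow>\<^sub>C real) set"
    and V\<^sub>1 V\<^sub>2 :: "'a \<Rightarrow>\<^sub>C real"
    and \<mu> :: "'a measure"
  assumes "compact (UNIV :: 'a set)"
    and "markov_semigroup P"
    and "cond_A P" and "cond_B P" and "cond_C P D" and "cond_D P D"
    and "smooth_potential P D V\<^sub>1" and "smooth_potential P D V\<^sub>2"
    and "equilibrium_measure P V\<^sub>1 \<mu>" and "equilibrium_measure P V\<^sub>2 \<mu>"
  shows "\<exists>c. V\<^sub>1 - V\<^sub>2 = const_bcontfun c"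
proof -
  interpret markov P
    by standard (rule assms(2))
  note cpt = assms(1)
  let ?L = "generator P"
  have D: "subspace D" "D \<subseteq> gen_domain P"
    and D_mult: "\<And>f g. f \<in> D \<Longrightarrow> g \<in> D \<Longrightarrow> bc_mult f g \<in> D"
    and D_div: "\<And>f g. f \<in> D \<Longrightarrow> g \<in> D \<Longrightarrow> (\<And>x. apply_bcontfun g x > 0) \<Longrightarrow> \<exists>h\<in>D. \<forall>x. h x = f x / g x"
    using \<open>cond_C P D\<close> unfolding cond_C_def is_core_def by blast+
  have \<mu>: "borel_prob \<mu>"
    using assms(9) by (simp add: equilibrium_measure_def)
  note integrable = borel_prob_integrable_continuous[OF cpt \<mu>]
  obtain \<psi>\<^sub>1 l\<^sub>1 where \<psi>1: "\<psi>\<^sub>1 \<in> D" "\<And>x. apply_bcontfun \<psi>\<^sub>1 x > 0" "\<And>x. ?L \<psi>\<^sub>1 x = (l\<^sub>1 - V\<^sub>1 x) * \<psi>\<^sub>1 x"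
    and stat1: "\<And>g. g \<in> gen_domain P \<Longrightarrow> (\<integral>x. (?L g x + (V\<^sub>1 x - l\<^sub>1) * g x) / \<psi>\<^sub>1 x \<partial>\<mu>) = 0"
    using equilibrium_ground_state[OF cpt assms(3,7) D assms(9)] by blast
  obtain \<psi>\<^sub>2 l\<^sub>2 where \<psi>2: "\<psi>\<^sub>2 \<in> D" "\<And>x. apply_bcontfun \<psi>\<^sub>2 x > 0" "\<And>x. ?L \<psi>\<^sub>2 x = (l\<^sub>2 - V\<^sub>2 x) * \<psi>\<^sub>2 x"
    and stat2: "\<And>g. g \<in> gen_domain P \<Longrightarrow> (\<integral>x. (?L g x + (V\<^sub>2 x - l\<^sub>2) * g x) / \<psi>\<^sub>2 x \<partial>\<mu>) = 0"
    using equilibrium_ground_state[OF cpt assms(3,8) D assms(10)] by blast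
  have ne: "\<psi>\<^sub>1 x \<noteq> 0" "\<psi>\<^sub>2 x \<noteq> 0" for x
    using \<psi>1(2)[of x] \<psi>2(2)[of x] by auto
  obtain h where "h \<in> D" and h: "\<And>x. h x = \<psi>\<^sub>2 x / \<psi>\<^sub>1 x"
    using D_div[OF \<psi>2(1) \<psi>1(1,2)] by blast
  define k where "k = bc_mult \<psi>\<^sub>1 (bc_mult h h)"
  have dom: "h \<in> gen_domain P" "bc_mult h h \<in> gen_domain P" "\<psi>\<^sub>1 \<in> gen_domain P" "\<psi>\<^sub>2 \<in> gen_domain P" "k \<in> gen_domain P"
    using D(2) D_mult \<open>h \<in> D\<close> \<psi>1(1) \<psi>2(1) unfolding k_def by blast+
  have \<psi>1_h: "bc_mult \<psi>\<^sub>1 h = \<psi>\<^sub>2"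
    by (rule bcontfun_eqI) (simp add: h ne)
  obtain m where m: "m > 0" "\<And>x. m \<le> \<psi>\<^sub>1 x"
    using positive_bounded_below[OF cpt \<psi>1(2)] by blast
  define G where "G = ?L k - 2 *\<^sub>R bc_mult h (?L \<psi>\<^sub>2) + bc_mult (bc_mult h h) (?L \<psi>\<^sub>1)"
  have G_ge: "m * carre_du_champ P h x \<le> G x" for x
    using weighted_carre_du_champ_ge[of h \<psi>\<^sub>1 m x] dom m(2)
    by (simp add: G_def k_def \<psi>1_h power2_eq_square mult.assoc)
  have \<Gamma>_nonneg: "carre_du_champ P h x \<ge> 0" for x
    by (rule carre_du_champ_nonneg[OF dom(1,2)])
  \<comment> \<open>This is where the two test functions \<open>k = \<psi>\<^sub>1 h\<^sup>2\<close> and \<open>\<psi>\<^sub>2\<close> enter: the potentials cancel against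
    \<open>L\<psi>\<^sub>1 / \<psi>\<^sub>1\<close> and \<open>L\<psi>\<^sub>2 / \<psi>\<^sub>2\<close>.\<close>
  have "G x / \<psi>\<^sub>2 x = (?L k x + (V\<^sub>2 x - l\<^sub>2) * k x) / \<psi>\<^sub>2 x - (?L \<psi>\<^sub>2 x + (V\<^sub>1 x - l\<^sub>1) * \<psi>\<^sub>2 x) / \<psi>\<^sub>1 x" for x
    using ne[of x] by (simp add: G_def k_def h \<psi>1(3) \<psi>2(3) field_simps power2_eq_square)
  then have "(\<integral>x. G x / \<psi>\<^sub>2 x \<partial>\<mu>) =
      (\<integral>x. (?L k x + (V\<^sub>2 x - l\<^sub>2) * k x) / \<psi>\<^sub>2 x - (?L \<psi>\<^sub>2 x + (V\<^sub>1 x - l\<^sub>1) * \<psi>\<^sub>2 x) / \<psi>\<^sub>1 x \<partial>\<mu>)"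
    by presburger
  also have "\<dots> = (\<integral>x. (?L k x + (V\<^sub>2 x - l\<^sub>2) * k x) / \<psi>\<^sub>2 x \<partial>\<mu>) -
      (\<integral>x. (?L \<psi>\<^sub>2 x + (V\<^sub>1 x - l\<^sub>1) * \<psi>\<^sub>2 x) / \<psi>\<^sub>1 x \<partial>\<mu>)"
    by (intro Bochner_Integration.integral_diff integrable continuous_intros) (auto simp: ne)
  also have "\<dots> = 0"
    using stat1[OF dom(4)] stat2[OF dom(5)] by simp
  finally have G_int: "(\<integral>x. G x / \<psi>\<^sub>2 x \<partial>\<mu>) = 0" .
  have "G x \<ge> 0" for x
    using G_ge[of x] \<Gamma>_nonneg[of x] m(1) by (meson mult_nonneg_nonneg less_imp_le order_trans)
  then have "G = 0"
    using stationary_measure_full_support[OF cpt assms(4) \<mu> \<psi>2(2) stat2] G_int by force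
  then have "carre_du_champ P h = 0"
    using G_ge \<Gamma>_nonneg m(1) by (intro bcontfun_eqI) (simp add: antisym mult_le_0_iff)
  then obtain c where c: "h = const_bcontfun c"
    using \<open>cond_D P D\<close> \<open>h \<in> D\<close> unfolding cond_D_def by blast
  have proportional: "\<psi>\<^sub>2 = c *\<^sub>R \<psi>\<^sub>1"
    unfolding \<psi>1_h[symmetric] c by (rule bcontfun_eqI) simp
  have "V\<^sub>1 x - V\<^sub>2 x = l\<^sub>1 - l\<^sub>2" for x
  proof -
    have "(l\<^sub>2 - V\<^sub>2 x) * \<psi>\<^sub>2 x = c * ((l\<^sub>1 - V\<^sub>1 x) * \<psi>\<^sub>1 x)"
      using \<psi>2(3)[of x] generator_scaleR(2)[OF dom(3), of c] \<psi>1(3)[of x] by (auto simp: proportional)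
    then have "(l\<^sub>2 - V\<^sub>2 x) * \<psi>\<^sub>2 x = (l\<^sub>1 - V\<^sub>1 x) * \<psi>\<^sub>2 x"
      by (simp add: proportional)
    then show ?thesis
      using ne(2)[of x] by simp
  qed
  then show ?thesis
    by (intro exI[of _ "l\<^sub>1 - l\<^sub>2"] bcontfun_eqI) simp
qed

end
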